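(* Let $d\ge 2$ be an integer. For every $n\ge 1$, the closure $\overline{X_n}$ of $X_n$ in $\mathbb{C}^2$ is smooth.
   Context: For $c\in\mathbb{C}$ put $f_c(z)=z^d+c$, and let $f_c^{m}$ denote the $m$-th iterate of $f_c$. For $n\ge1$, $$X_n:=\{(c,z)\in\mathbb{C}^2 \mid f_c^{n}(z)=z,\ (f_c^{n})'(z)\neq 1,\ \text{and } f_c^{m}(z)\neq z \text{ for all } 0<m<n\}.$$ Smooth means that every point of $\overline{X_n}$ has a neighborhood in $\mathbb{C}^2$ in which $\overline{X_n}$ is a one-dimensional complex submanifold. *)

theory Defs
  imports "HOL-Analysis.Analysis"
begin

definition unicritical :: "nat \<Rightarrow> complex \<Rightarrow> complex \<Rightarrow> complex" where
  "unicritical d c z = z ^ d + c"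

definition dynatomic_set :: "nat \<Rightarrow> nat \<Rightarrow> (complex \<times> complex) set" where
  "dynatomic_set d n =
    {(c, z). (unicritical d c ^^ n) z = z \<and>
             deriv (unicritical d c ^^ n) z \<noteq> 1 \<and>
             (\<forall>m. 0 < m \<and> m < n \<longrightarrow> (unicritical d c ^^ m) z \<noteq> z)}"

text \<open>The library has no holomorphic maps of several variables. A map is holomorphic on an open
  subset of \<open>\<complex>\<^sup>2\<close> if at each point it has a total (real) derivative that is
  moreover \<open>\<complex>\<close>-linear.\<close>

definition holomorphic2_on ::
    "(complex \<times> complex \<Rightarrow> complex \<times> complex) \<Rightarrow> (complex \<times> complex) set \<Rightarrow> bool" where
  "holomorphic2_on f U \<longleftrightarrow>
    (\<forall>p\<in>U. \<exists>f'. (f has_derivative f') (at p) \<and>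
      (\<forall>a u v. f' (a * u, a * v) = (a * fst (f' (u, v)), a * snd (f' (u, v)))))"

definition biholomorphic2 ::
    "(complex \<times> complex \<Rightarrow> complex \<times> complex) \<Rightarrow>
     (complex \<times> complex) set \<Rightarrow> (complex \<times> complex) set \<Rightarrow> bool" where
  "biholomorphic2 f U V \<longleftrightarrow>
    open U \<and> open V \<and> bij_betw f U V \<and> holomorphic2_on f U \<and> holomorphic2_on (inv_into U f) V"

text \<open>Submanifold means embedded submanifold: near each of its points, a biholomorphic change of
  coordinates of the ambient space straightens the set to the line \<open>w = 0\<close>.\<close>

definition complex_submanifold_dim1 :: "(complex \<times> complex) set \<Rightarrow> bool" where
  "complex_submanifold_dim1 M \<longleftrightarrow>
    (\<forall>p\<in>M. \<exists>U V f. p \<in> U \<and> biholomorphic2 f U V \<and> f ` (M \<inter> U) = {(t, w) \<in> V. w = 0})"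

definition smooth_curve :: "(complex \<times> complex) set \<Rightarrow> bool" where
  "smooth_curve S \<longleftrightarrow> (\<forall>p\<in>S. \<exists>N. open N \<and> p \<in> N \<and> complex_submanifold_dim1 (S \<inter> N))"

end

theory Submission
  imports Defs "HOL-Complex_Analysis.Complex_Singularities"
begin

text \<open>
  A point \<open>p = (c\<^sub>0, z\<^sub>0)\<close> of the closure of \<open>X\<^sub>n\<close> lies on a cycle of some exact period \<open>m\<close>
  dividing \<open>n\<close>. Write \<open>n = q * m\<close>, let \<open>\<mu>\<close> be the multiplier of that cycle and \<open>F\<close> the \<open>m\<close>-th
  iterate of \<open>f\<^sub>c\<close>. Near \<open>p\<close> the closure is the zero set of a polynomial \<open>h\<close> whose
  gradient does not vanish at \<open>p\<close>, and the holomorphic inverse function theorem straightens it.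

  If \<open>q = 1\<close>, then \<open>h = F(z) - z\<close>. For \<open>\<mu> \<noteq> 1\<close> its \<open>z\<close>-derivative \<open>\<mu> - 1\<close> is nonzero; for \<open>\<mu> = 1\<close>
  its \<open>c\<close>-derivative has to be nonzero.
  If \<open>q > 1\<close>, then \<open>h\<close> is the quotient of \<open>F\<^sup>q(z) - z\<close> by \<open>F(z) - z\<close>, a polynomial which equals
  \<open>1 + \<mu> + \<dots> + \<mu>\<^sup>q\<^sup>-\<^sup>1\<close> at fixed points of \<open>F\<close> with multiplier \<open>\<mu>\<close>. It has to vanish at \<open>p\<close>, and the same is true with
  any other multiple of \<open>m\<close> properly dividing \<open>n\<close> in place of \<open>m\<close>, so \<open>\<mu>\<close> is a primitive \<open>q\<close>-th
  root of unity. Along the curve of fixed points of \<open>F\<close> through \<open>p\<close> the multiplier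
  moves with nonzero speed, hence so does \<open>h\<close>: the curves \<open>h = 0\<close> and \<open>F(z) = z\<close> cross
  transversally at \<open>p\<close>. In either case the zeros of \<open>h\<close> near \<open>p\<close>, apart from \<open>p\<close> itself, are
  points of exact period \<open>n\<close> with multiplier different from 1, since zeros with multiplier 1 are
  points with a vertical tangent, and these are isolated.

  The two transversality facts (\<open>parabolic_cycle_no_cyclic_velocity\<close> and
  \<open>indifferent_cycle_multiplier_velocity\<close>) are proved by the method of Thurston and Epstein. Let
  \<open>a\<^sub>0, \<dots>, a\<^sub>m\<^sub>-\<^sub>1\<close> be the cycle and consider a quadratic differential \<open>Q dz\<^sup>2\<close> with
  \<open>Q = \<Sum> \<alpha> / (z - a\<^sub>k)\<^sup>2 + \<rho>\<^sub>k / (z - a\<^sub>k)\<close>. Pushing it forward by \<open>f\<^sub>c\<close> gives again such a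
  differential, plus a simple pole at the critical value \<open>c\<close>. With \<open>\<alpha> = 0\<close> if the multiplier is 1,
  and with \<open>\<alpha> = 1\<close> if it is not, the \<open>\<rho>\<^sub>k\<close> can be chosen such that the principal parts along the
  cycle are reproduced (\<open>pushforward_polar_part\<close>), and the residue at \<open>c\<close> is, up to a factor, the
  derivative in question (\<open>cyclic_velocity_sum\<close>). If that derivative were zero, \<open>Q dz\<^sup>2\<close> would be
  invariant. But pushing forward does not increase the area norm (\<open>pushforward_L1_le\<close>), while the
  preimage of a large disc lies well inside the disc, so an invariant \<open>Q\<close> would vanish on an
  annulus (\<open>invariant_polar_part_trivial\<close>). The double poles are not integrable, so small discs
  around the cycle have to be removed; as the cycle is indifferent, their radii can be chosen such
  that the preimage of the removed discs differs from them by annuli of negligible norm.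
\<close>

section \<open>Conformal change of variables in the plane\<close>

text \<open>The change of variables formula lives on \<open>real^2\<close>; these two maps transport it to the complex
  plane.\<close>

definition plane_to_complex :: "real^2 \<Rightarrow> complex" where
  "plane_to_complex v = Complex (v$1) (v$2)"

definition complex_to_plane :: "complex \<Rightarrow> real^2" where
  "complex_to_plane z = vector [Re z, Im z]"

lemma plane_complex_inverse [simp]:
  "plane_to_complex (complex_to_plane z) = z" "complex_to_plane (plane_to_complex v) = v"
  by (auto simp: plane_to_complex_def complex_to_plane_def vec_eq_iff forall_2)

lemma bounded_linear_plane_complex:
  "bounded_linear plane_to_complex" "bounded_linear complex_to_plane"
  by (auto simp: linear_conv_bounded_linear[symmetric] linear_iff plane_to_complex_def complex_to_plane_def complex_eq_iff vec_eq_iff forall_2)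

lemma plane_complex_measurable [measurable]:
  "plane_to_complex \<in> borel_measurable borel" "complex_to_plane \<in> borel_measurable borel"
  using bounded_linear_plane_complex
  by (auto intro!: borel_measurable_continuous_onI linear_continuous_on)

lemma lborel_complex_eq_distr: "lborel = distr lborel borel plane_to_complex"
proof (rule lborel_eqI)
  fix l u :: complex
  assume le: "\<And>b. b \<in> Basis \<Longrightarrow> l \<bullet> b \<le> u \<bullet> b"
  have le': "Re l \<le> Re u" "Im l \<le> Im u"
    using le[of 1] le[of \<i>] by (auto simp: Basis_complex_def inner_complex_def)
  have *: "plane_to_complex -` box l u = box (complex_to_plane l) (complex_to_plane u)"
    by (auto simp: mem_box_cart in_box_complex_iff forall_2 plane_to_complex_def complex_to_plane_def)
  have "emeasure (distr lborel borel plane_to_complex) (box l u)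
        = emeasure lborel (box (complex_to_plane l) (complex_to_plane u))"
    by (subst emeasure_distr) (auto simp: *)
  also have "\<dots> = (\<Prod>b\<in>Basis. (complex_to_plane u - complex_to_plane l) \<bullet> b)"
  proof (subst emeasure_lborel_box)
    fix b :: "real^2" assume "b \<in> Basis"
    then obtain i where b: "b = axis i 1" by (auto simp: Basis_vec_def)
    show "complex_to_plane l \<bullet> b \<le> complex_to_plane u \<bullet> b"
      using le' exhaust_2[of i] by (auto simp: b inner_axis complex_to_plane_def)
  qed simp
  also have "\<dots> = (\<Prod>i\<in>UNIV. (complex_to_plane u - complex_to_plane l) $ i)"
    by (simp add: Basis_vec_def UNION_singleton_eq_range prod.reindex inner_axis inj_on_def axis_eq_axis)
  also have "\<dots> = (Re u - Re l) * (Im u - Im l)"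
    by (simp add: UNIV_2 complex_to_plane_def)
  also have "\<dots> = (\<Prod>b\<in>Basis. (u - l) \<bullet> b)"
    by (simp add: Basis_complex_def inner_complex_def)
  finally show "emeasure (distr lborel borel plane_to_complex) (box l u) = (\<Prod>b\<in>Basis. (u - l) \<bullet> b)" .
qed simp

text \<open>Multiplication by a complex number is a rotation followed by a scaling.\<close>

lemma det_complex_mult:
  "det (matrix (\<lambda>v. complex_to_plane (a * plane_to_complex v))) = (cmod a)\<^sup>2"
  by (simp add: det_2 matrix_def complex_to_plane_def plane_to_complex_def axis_def
      cmod_power2 flip: power2_eq_square)

lemma nn_integral_plane:
  assumes "f \<in> borel_measurable borel"
  shows "(\<integral>\<^sup>+z. f z \<partial>lborel) = (\<integral>\<^sup>+v. f (plane_to_complex v) \<partial>lborel)"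
  by (subst lborel_complex_eq_distr, subst nn_integral_distr) (use assms in auto)


lemma has_derivative_in_plane_coordinates:
  assumes "(s has_field_derivative a) (at (plane_to_complex v))"
  shows "((\<lambda>v. complex_to_plane (s (plane_to_complex v))) has_derivative
           (\<lambda>w. complex_to_plane (a * plane_to_complex w))) (at v within S)"
proof -
  have "((\<lambda>v. s (plane_to_complex v)) has_derivative (\<lambda>w. a * plane_to_complex w)) (at v)"
    using has_derivative_compose[OF bounded_linear_imp_has_derivative[OF bounded_linear_plane_complex(1)]
      assms[unfolded has_field_derivative_def]] by simp
  from bounded_linear.has_derivative[OF bounded_linear_plane_complex(2) this]
  show ?thesis by (rule has_derivative_at_withinI)
qed

text \<open>The Jacobian of a holomorphic map is the squared modulus of its derivative. This is the factor by
  which the coefficient of a quadratic differential changes, so that \<open>|Q| dx dy\<close> is a measure that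
  does not depend on the coordinate.\<close>

lemma nn_integral_conformal_change_of_variables:
  fixes h :: "complex \<Rightarrow> real"
  assumes W: "open W" "open (s ` W)"
    and der: "\<And>z. z \<in> W \<Longrightarrow> (s has_field_derivative s' z) (at z)"
    and inj: "inj_on s W"
    and h: "h \<in> borel_measurable borel" "\<And>z. h z \<ge> 0"
    and fin: "(\<integral>\<^sup>+z. ennreal (h z) * indicator (s ` W) z \<partial>lborel) < \<infinity>"
  shows "(\<integral>\<^sup>+z. ennreal (h (s z) * (cmod (s' z))\<^sup>2) * indicator W z \<partial>lborel) =
         (\<integral>\<^sup>+z. ennreal (h z) * indicator (s ` W) z \<partial>lborel)"
proof -
  let ?f = "\<lambda>v. vec (h (plane_to_complex v)) :: real^1"
  have holo: "s holomorphic_on W"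
    using der by (auto simp: holomorphic_on_open[OF W(1)])
  have cont: "continuous_on W s" "continuous_on W (deriv s)"
    using holo holomorphic_deriv[OF holo W(1)] by (auto intro: holomorphic_on_imp_continuous_on)
  moreover have "deriv s z = s' z" if "z \<in> W" for z
    using der that by (simp add: DERIV_imp_deriv)
  ultimately have "continuous_on W s'"
    by (metis continuous_on_cong)
  note cont = cont(1) this
  have [measurable]: "W \<in> sets borel" "s ` W \<in> sets borel" "h \<in> borel_measurable borel"
    using W h by auto
  have [measurable]: "(\<lambda>z. if z \<in> W then s z else 0) \<in> borel_measurable borel"
      "(\<lambda>z. if z \<in> W then s' z else 0) \<in> borel_measurable borel"
    using W cont by (auto intro!: borel_measurable_continuous_on_if)
  have "(\<lambda>z. indicator W z * (h (if z \<in> W then s z else 0) * (cmod (if z \<in> W then s' z else 0))\<^sup>2))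
      \<in> borel_measurable borel"
    by measurable
  also have "(\<lambda>z. indicator W z * (h (if z \<in> W then s z else 0) * (cmod (if z \<in> W then s' z else 0))\<^sup>2))
      = (\<lambda>z. indicator W z * (h (s z) * (cmod (s' z))\<^sup>2))"
    by (auto simp: fun_eq_iff indicator_def)
  finally have m: "(\<lambda>z. indicator W z * (h (s z) * (cmod (s' z))\<^sup>2)) \<in> borel_measurable borel" .
  define S where "S = plane_to_complex -` W"
  define g where "g = (\<lambda>v. complex_to_plane (s (plane_to_complex v)))"
  define g' where "g' = (\<lambda>v w. complex_to_plane (s' (plane_to_complex v) * plane_to_complex w))"
  have S: "open S" unfolding S_def
    using W bounded_linear_plane_complex(1) by (intro open_vimage linear_continuous_on)
  have gS: "g ` S = plane_to_complex -` (s ` W)"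
  proof (intro equalityI subsetI)
    fix v assume "v \<in> plane_to_complex -` (s ` W)"
    then obtain z where "z \<in> W" "plane_to_complex v = s z" by auto
    then have "complex_to_plane z \<in> S" "g (complex_to_plane z) = v"
      by (auto simp: S_def g_def) (metis plane_complex_inverse(2))
    then show "v \<in> g ` S" by blast
  qed (auto simp: g_def S_def)
  have der_g: "(g has_derivative g' v) (at v within S)" if "v \<in> S" for v
    unfolding g_def g'_def using that S_def by (intro has_derivative_in_plane_coordinates der) auto
  have inj_g: "inj_on g S"
    using inj unfolding inj_on_def g_def S_def by (metis plane_complex_inverse vimageE)
  have detg: "\<bar>det (matrix (g' v))\<bar> = (cmod (s' (plane_to_complex v)))\<^sup>2" for v
    unfolding g'_def det_complex_mult by simp
  define r where "r = enn2real (\<integral>\<^sup>+z. ennreal (h z) * indicator (s ` W) z \<partial>lborel)"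
  have mh: "(\<lambda>z. ennreal (h z) * indicator (s ` W) z) \<in> borel_measurable borel"
    using W h by measurable
  have r: "(\<integral>\<^sup>+z. ennreal (h z) * indicator (s ` W) z \<partial>lborel) = ennreal r"
    unfolding r_def using fin by (simp add: ennreal_enn2real)
  let ?k = "\<lambda>v. h (plane_to_complex v) * indicator (g ` S) v"
  have "(?k has_integral r) UNIV"
  proof (rule nn_integral_has_integral)
    have "open (g ` S)" unfolding gS
      using W bounded_linear_plane_complex(1) by (intro open_vimage linear_continuous_on)
    then have [measurable]: "g ` S \<in> sets borel" by simp
    show "?k \<in> borel_measurable borel" by measurable
    show "(\<integral>\<^sup>+ x. ennreal (?k x) \<partial>lborel) = ennreal r"
      unfolding r[symmetric] nn_integral_plane[OF mh] gS
      by (intro nn_integral_cong) (auto simp: indicator_def)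
  qed (use h in \<open>auto simp: r_def\<close>)
  also have "?k = (\<lambda>v. if v \<in> g ` S then h (plane_to_complex v) else 0)"
    by (auto simp: fun_eq_iff)
  finally have hi: "((\<lambda>v. h (plane_to_complex v)) has_integral r) (g ` S)"
    by (simp only: has_integral_restrict_UNIV)
  have ai: "(\<lambda>v. h (plane_to_complex v)) absolutely_integrable_on (g ` S)"
    using hi h by (subst absolutely_integrable_on_iff_nonneg) auto
  have "?f absolutely_integrable_on (g ` S) \<and> integral (g ` S) ?f = vec r"
    using ai hi by (auto simp: absolutely_integrable_on_1_iff integral_on_1_eq integral_unique o_def)
  then have *: "(\<lambda>v. \<bar>det (matrix (g' v))\<bar> *\<^sub>R ?f (g v)) absolutely_integrable_on S"
     "integral S (\<lambda>v. \<bar>det (matrix (g' v))\<bar> *\<^sub>R ?f (g v)) = vec r"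
    using has_absolute_integral_change_of_variables[of S g g' ?f "vec r"] S der_g inj_g by auto
  let ?l = "\<lambda>v. h (s (plane_to_complex v)) * (cmod (s' (plane_to_complex v)))\<^sup>2"
  have eq: "(\<lambda>v. (\<bar>det (matrix (g' v))\<bar> *\<^sub>R ?f (g v)) $ 1) = ?l"
    by (auto simp: detg g_def fun_eq_iff)
  have "?l absolutely_integrable_on S" "integral S ?l = r"
    using * unfolding absolutely_integrable_on_1_iff integral_on_1_eq o_def eq
    by (auto simp: vec_eq_iff)
  then have "(?l has_integral r) S"
    using set_lebesgue_integral_eq_integral(1) by blast
  then have "(\<integral>\<^sup>+v. ennreal (?l v) * indicator S v \<partial>lborel) = ennreal r"
    by (rule nn_integral_has_integral_lebesgue'[rotated]) (use h in auto)
  moreover have "(\<integral>\<^sup>+z. ennreal (h (s z) * (cmod (s' z))\<^sup>2) * indicator W z \<partial>lborel)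
     = (\<integral>\<^sup>+z. ennreal (indicator W z * (h (s z) * (cmod (s' z))\<^sup>2)) \<partial>lborel)"
    by (intro nn_integral_cong) (auto simp: indicator_def)
  moreover have "\<dots> = (\<integral>\<^sup>+v. ennreal (?l v) * indicator S v \<partial>lborel)"
    by (subst nn_integral_plane) (use m in \<open>auto simp: S_def indicator_def intro!: nn_integral_cong\<close>)
  ultimately show ?thesis using r by simp
qed

section \<open>Sums over the roots of a complex number\<close>

definition unity_root :: "nat \<Rightarrow> complex" where
  "unity_root d = exp (2 * of_real pi * \<i> / of_nat d)"

lemma unity_root_power_eq_1_iff:
  assumes "d \<ge> 1" shows "unity_root d ^ k = 1 \<longleftrightarrow> d dvd k"
  using complex_root_unity_eq_1[of d k] assms
  by (simp add: unity_root_def exp_of_nat_mult[symmetric] algebra_simps)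

lemma sum_unity_root_powers:
  assumes "d \<ge> 1"
  shows "(\<Sum>j<d. (unity_root d ^ j) ^ k) = (if d dvd k then of_nat d else 0)"
proof -
  have *: "(unity_root d ^ j) ^ k = (unity_root d ^ k) ^ j" for j
    by (simp add: power_mult[symmetric] mult.commute)
  show ?thesis
  proof (cases "d dvd k")
    case True
    then have "unity_root d ^ k = 1" using assms unity_root_power_eq_1_iff by blast
    then show ?thesis using True by (simp add: *)
  next
    case False
    then have "unity_root d ^ k \<noteq> 1" using assms unity_root_power_eq_1_iff by blast
    moreover have "(unity_root d ^ k) ^ d = 1"
      using unity_root_power_eq_1_iff[of d d] assms by (metis *  dvd_refl power_one)
    ultimately show ?thesis using False by (simp add: * geometric_sum)
  qed
qed

text \<open>The points \<open>w\<close> of the sum run over the \<open>d\<close>-th roots of \<open>s ^ d\<close>. Since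
  \<open>w ^ d - a ^ d\<close> is \<open>w - a\<close> times a geometric sum, each term is a polynomial in \<open>w\<close> over the common
  denominator \<open>s ^ d - a ^ d\<close>, and summing over all rotations of \<open>w\<close> kills every power of \<open>w\<close> except
  \<open>w ^ d\<close>.\<close>

lemma sum_over_roots_simple_pole:
  assumes d: "d \<ge> 2" and s: "s \<noteq> 0" and a: "a ^ d \<noteq> s ^ d"
  shows "(\<Sum>j<d. (unity_root d ^ j * s)\<^sup>2 / (unity_root d ^ j * s - a)) =
         of_nat d * a * s ^ d / (s ^ d - a ^ d)"
proof -
  let ?w = "\<lambda>j. unity_root d ^ j * s"
  have wd: "?w j ^ d = s ^ d" for j
    using unity_root_power_eq_1_iff[of d d] d
    by (simp add: power_mult_distrib power_mult[symmetric] mult.commute[of j]) (simp add: power_mult)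
  have "(?w j)\<^sup>2 / (?w j - a) = (\<Sum>i<d. a ^ (d - Suc i) * s ^ (i+2) * (unity_root d ^ j) ^ (i+2)) / (s ^ d - a ^ d)" for j
  proof -
    have ne: "?w j - a \<noteq> 0" using wd[of j] a by auto
    have "s ^ d - a ^ d = (?w j - a) * (\<Sum>i<d. a ^ (d - Suc i) * ?w j ^ i)"
      using power_diff_sumr2[of "?w j" d a] wd by simp
    then have "(?w j)\<^sup>2 * (s ^ d - a ^ d) = (?w j - a) * (\<Sum>i<d. a ^ (d - Suc i) * s ^ (i+2) * (unity_root d ^ j) ^ (i+2))"
      by (simp add: sum_distrib_left mult_ac power_add power_mult_distrib power2_eq_square)
    then show ?thesis using ne a by (simp add: field_simps)
  qed
  then have "(\<Sum>j<d. (?w j)\<^sup>2 / (?w j - a)) =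
     (\<Sum>j<d. \<Sum>i<d. a ^ (d - Suc i) * s ^ (i+2) * (unity_root d ^ j) ^ (i+2)) / (s ^ d - a ^ d)"
    by (simp add: sum_divide_distrib)
  also have "(\<Sum>j<d. \<Sum>i<d. a ^ (d - Suc i) * s ^ (i+2) * (unity_root d ^ j) ^ (i+2)) =
     (\<Sum>i<d. a ^ (d - Suc i) * s ^ (i+2) * (\<Sum>j<d. (unity_root d ^ j) ^ (i+2)))"
    by (subst sum.swap) (simp add: sum_distrib_left)
  also have "\<dots> = (\<Sum>i<d. if i = d - 2 then of_nat d * a * s ^ d else 0)"
  proof (rule sum.cong[OF refl])
    fix i assume i: "i \<in> {..<d}"
    (* the exponent i + 2 lies between 2 and d + 1, so d is its only multiple of d *)
    have "d dvd i + 2 \<longleftrightarrow> i = d - 2"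
    proof
      assume "d dvd i + 2"
      then obtain k where k: "i + 2 = d * k" by auto
      have "k < 2"
      proof (rule ccontr)
        assume "\<not> k < 2"
        then have "d * 2 \<le> d * k" by (intro mult_left_mono) auto
        with k i d show False by simp
      qed
      moreover have "k \<noteq> 0" using k by (cases k) auto
      ultimately have "k = 1" by linarith
      with k show "i = d - 2" by simp
    next
      assume "i = d - 2"
      with d have "i + 2 = d" by simp
      then show "d dvd i + 2" by simp
    qed
    moreover have "d - Suc (d - 2) = 1" using d by auto
    moreover have "s ^ (i + 2) = s ^ d" if "i = d - 2"
    proof -
      have "i + 2 = d" using that d by simp
      then show ?thesis by (rule arg_cong)
    qed
    ultimately show "a ^ (d - Suc i) * s ^ (i+2) * (\<Sum>j<d. (unity_root d ^ j) ^ (i+2)) =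
        (if i = d - 2 then of_nat d * a * s ^ d else 0)"
      using d by (subst sum_unity_root_powers) (auto simp del: add_2_eq_Suc')
  qed
  also have "\<dots> = of_nat d * a * s ^ d" using d by simp
  finally show ?thesis .
qed

text \<open>This is the derivative of the previous identity with respect to \<open>a\<close>.\<close>

lemma sum_over_roots_double_pole:
  assumes d: "d \<ge> 2" and s: "s \<noteq> 0" and a: "a ^ d \<noteq> s ^ d"
  shows "(\<Sum>j<d. (unity_root d ^ j * s)\<^sup>2 / (unity_root d ^ j * s - a)\<^sup>2) =
         of_nat d * s ^ d * ((s ^ d - a ^ d) + of_nat d * a ^ d) / (s ^ d - a ^ d)\<^sup>2"
proof -
  let ?w = "\<lambda>j. unity_root d ^ j * s"
  have wd: "?w j ^ d = s ^ d" for j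
    using unity_root_power_eq_1_iff[of d d] d
    by (simp add: power_mult_distrib power_mult[symmetric] mult.commute[of j]) (simp add: power_mult)
  have ne: "?w j \<noteq> a" for j using wd[of j] a by auto
  have "((\<lambda>a. \<Sum>j<d. (?w j)\<^sup>2 / (?w j - a)) has_field_derivative
      (\<Sum>j<d. (?w j)\<^sup>2 / (?w j - a)\<^sup>2)) (at a)"
    using ne by (auto intro!: derivative_eq_intros sum.cong simp: power2_eq_square)
  moreover have "((\<lambda>a. of_nat d * a * s ^ d / (s ^ d - a ^ d)) has_field_derivative
      of_nat d * s ^ d * ((s ^ d - a ^ d) + of_nat d * a ^ d) / (s ^ d - a ^ d)\<^sup>2) (at a)"
  proof -
    have "a * a ^ (d - 1) = a ^ d" using d by (metis One_nat_def Suc_le_D Suc_1 diff_Suc_1 power_Suc)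
    then show ?thesis using a
      by (auto intro!: derivative_eq_intros simp: power2_eq_square algebra_simps add_divide_distrib)
  qed
  then have "((\<lambda>a. \<Sum>j<d. (?w j)\<^sup>2 / (?w j - a)) has_field_derivative
      of_nat d * s ^ d * ((s ^ d - a ^ d) + of_nat d * a ^ d) / (s ^ d - a ^ d)\<^sup>2) (at a)"
  proof (rule DERIV_cong_ev[THEN iffD1, rotated 3, OF _ ] , goal_cases)
    case 2
    have "open {b. b ^ d \<noteq> s ^ d}"
      by (intro open_Collect_neq continuous_intros)
    from eventually_nhds_in_open[OF this, of a] a show ?case
      by (auto elim!: eventually_mono simp: sum_over_roots_simple_pole[OF d s])
  qed auto
  ultimately show ?thesis by (rule DERIV_unique)
qed

section \<open>Push-forward of quadratic differentials does not increase the area norm\<close>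

lemma AE_not_in_slit: "AE z in lborel. z - c \<notin> \<real>\<^sub>\<le>\<^sub>0" for c :: complex
proof -
  have "negligible {z. \<i> \<bullet> z = \<i> \<bullet> c}"
    by (rule negligible_hyperplane) simp
  moreover have "{z. \<i> \<bullet> z = \<i> \<bullet> c} \<in> sets borel"
    by (intro borel_closed closed_hyperplane)
  ultimately have "{z. \<i> \<bullet> z = \<i> \<bullet> c} \<in> null_sets lborel"
    by (simp add: negligible_iff_null_sets null_sets_completion_iff)
  moreover have "z \<in> {z. \<i> \<bullet> z = \<i> \<bullet> c}" if "z - c \<in> \<real>\<^sub>\<le>\<^sub>0" for z
    using that by (auto simp: complex_nonpos_Reals_iff inner_complex_def)
  ultimately show ?thesis by (intro AE_I'[of "{z. \<i> \<bullet> z = \<i> \<bullet> c}"]) blast+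
qed

text \<open>The last hypothesis says that over \<open>B\<close> the quadratic differential \<open>Q dz\<^sup>2\<close> equals its push-forward
  under \<open>w \<mapsto> w ^ d + c\<close>, the sum of its pull-backs by the \<open>d\<close> inverse branches. By the triangle
  inequality its norm over \<open>B\<close> is at most the sum of the norms over the images of \<open>B\<close> under the
  branches, and these images are disjoint subsets of the preimage of \<open>B\<close>. A half-line starting at
  \<open>c\<close>, which is negligible, is removed from \<open>B\<close> to make the branches single-valued.\<close>

lemma pushforward_L1_le:
  fixes Q :: "complex \<Rightarrow> complex" and B P :: "complex set"
  assumes d: "d \<ge> 2" and B: "open B" and P: "P \<in> sets borel"
    and Q: "Q \<in> borel_measurable borel"
    and pre: "\<And>w. w ^ d + c \<in> B \<Longrightarrow> w \<in> P"
    and fin: "(\<integral>\<^sup>+z. ennreal (cmod (Q z)) * indicator P z \<partial>lborel) < \<infinity>"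
    and push: "\<And>s. s ^ d + c \<in> B \<Longrightarrow> s \<noteq> 0 \<Longrightarrow>
      Q (s ^ d + c) = (\<Sum>j<d. Q (unity_root d ^ j * s) * (unity_root d ^ j * s / (of_nat d * s ^ d))\<^sup>2)"
  shows "(\<integral>\<^sup>+z. ennreal (cmod (Q z)) * indicator B z \<partial>lborel)
          \<le> (\<integral>\<^sup>+z. ennreal (cmod (Q z)) * indicator P z \<partial>lborel)"
proof -
  define W where "W = B \<inter> {z. z - c \<notin> \<real>\<^sub>\<le>\<^sub>0}"
  define s where "s = (\<lambda>j z. unity_root d ^ j * exp (Ln (z - c) / of_nat d))"
  define s' where "s' = (\<lambda>j z. s j z / (of_nat d * (z - c)))"
  have "open {z. z - c \<notin> \<real>\<^sub>\<le>\<^sub>0}"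
    using open_vimage[of "- \<real>\<^sub>\<le>\<^sub>0" "\<lambda>z. z - c"]
    by (simp add: vimage_def open_Compl continuous_on_diff)
  then have W: "open W" using B by (auto simp: W_def)
  have Wne: "z \<noteq> c" if "z \<in> W" for z using that by (auto simp: W_def)
  have u: "unity_root d ^ d = 1" using unity_root_power_eq_1_iff[of d d] d by simp
  have ne: "unity_root d \<noteq> 0" by (simp add: unity_root_def)
  have s_ne: "s j z \<noteq> 0" for j z using ne by (simp add: s_def)
  have spow: "s j z ^ d + c = z" if "z \<in> W" for j z
  proof -
    have "(unity_root d ^ j) ^ d = 1" by (metis u mult.commute power_mult power_one)
    moreover have "exp (Ln (z - c) / of_nat d) ^ d = z - c"
      using d Wne[OF that] by (simp add: exp_of_nat_mult[symmetric])
    ultimately show ?thesis by (simp add: s_def power_mult_distrib)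
  qed
  have der: "(s j has_field_derivative s' j z) (at z)" if "z \<in> W" for j z
    unfolding s_def s'_def using that Wne[OF that] d
    by (auto intro!: derivative_eq_intros simp: W_def field_simps)
  have inj: "inj_on (s j) W" for j
    using spow by (metis inj_onI)
  have holo: "s j holomorphic_on W" for j
    using der by (auto simp: holomorphic_on_open[OF W])
  have op: "open (s j ` W)" for j
    using open_mapping_thm3[OF holo W inj] .
  have sub: "s j ` W \<subseteq> P" for j
    using pre spow by (auto simp: W_def image_subset_iff)
  have disj: "i = j" if "z \<in> s i ` W" "z \<in> s j ` W" "i < d" "j < d" for i j z
  proof -
    obtain x y where x: "x \<in> W" "z = s i x" and y: "y \<in> W" "z = s j y"
      using \<open>z \<in> s i ` W\<close> \<open>z \<in> s j ` W\<close> by auto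
    then have "x = y" using spow by metis
    then have "unity_root d ^ i = unity_root d ^ j" using x y by (simp add: s_def)
    moreover have "unity_root d ^ i = exp (2 * of_real pi * \<i> * of_nat i / of_nat d)" for i
      unfolding unity_root_def exp_of_nat_mult[symmetric] by (rule arg_cong[where f = exp]) simp
    ultimately have "i mod d = j mod d"
      using complex_root_unity_eq[of d i j] d by auto
    with that show "i = j" by simp
  qed
  have sum_le: "(\<Sum>j<d. indicator (s j ` W) z) \<le> (indicator P z :: ennreal)" for z
  proof (cases "\<exists>i<d. z \<in> s i ` W")
    case True
    then obtain i where i: "i < d" "z \<in> s i ` W" by blast
    have "(\<Sum>j<d. indicator (s j ` W) z) = (\<Sum>j<d. if j = i then 1 else 0 :: ennreal)"
    proof (intro sum.cong refl)
      fix j assume "j \<in> {..<d}"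
      then have "z \<in> s j ` W \<longleftrightarrow> j = i" using disj[of z i j] i by blast
      then show "indicator (s j ` W) z = (if j = i then 1 else 0 :: ennreal)"
        by (simp only: indicator_def of_bool_def)
    qed
    also have "\<dots> = 1" using i by simp
    also have "\<dots> = indicator P z" using i(2) sub[of i] by (simp add: indicator_def subset_iff)
    finally show ?thesis by simp
  next
    case False
    then have "(\<Sum>j<d. indicator (s j ` W) z) = (0::ennreal)" by (intro sum.neutral) auto
    then show ?thesis by simp
  qed
  have [measurable]: "W \<in> sets borel" "P \<in> sets borel" "s j ` W \<in> sets borel" "Q \<in> borel_measurable borel" for j
    using W P op Q by auto
  have "(\<integral>\<^sup>+z. ennreal (cmod (Q z)) * indicator B z \<partial>lborel) =
        (\<integral>\<^sup>+z. ennreal (cmod (Q z)) * indicator W z \<partial>lborel)"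
    using AE_not_in_slit[of c]
    by (intro nn_integral_cong_AE) (auto elim!: eventually_mono simp: W_def indicator_def)
  also have "\<dots> \<le> (\<integral>\<^sup>+z. (\<Sum>j<d. ennreal (cmod (Q (s j z)) * (cmod (s' j z))\<^sup>2) * indicator W z) \<partial>lborel)"
  proof (intro nn_integral_mono)
    fix z
    show "ennreal (cmod (Q z)) * indicator W z \<le>
       (\<Sum>j<d. ennreal (cmod (Q (s j z)) * (cmod (s' j z))\<^sup>2) * indicator W z)"
    proof (cases "z \<in> W")
      case True
      have zz: "s 0 z ^ d + c = z" "s 0 z ^ d = z - c" using spow[OF True, of 0] by (auto simp: algebra_simps)
      have "Q z = (\<Sum>j<d. Q (s j z) * (s' j z)\<^sup>2)"
        using push[of "s 0 z"] True s_ne[of 0 z] unfolding zz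
        by (simp add: W_def s_def s'_def)
      then have "cmod (Q z) \<le> (\<Sum>j<d. cmod (Q (s j z)) * (cmod (s' j z))\<^sup>2)"
        using norm_sum[of "\<lambda>j. Q (s j z) * (s' j z)\<^sup>2" "{..<d}"] by (simp add: norm_mult norm_power)
      then show ?thesis using True by (simp add: sum_ennreal ennreal_leI)
    qed simp
  qed
  also have "\<dots> = (\<Sum>j<d. \<integral>\<^sup>+z. ennreal (cmod (Q (s j z)) * (cmod (s' j z))\<^sup>2) * indicator W z \<partial>lborel)"
  proof (intro nn_integral_sum)
    fix j
    have [measurable]: "(\<lambda>z. if z \<in> W then s j z else 0) \<in> borel_measurable borel"
      using W holo by (auto intro!: borel_measurable_continuous_on_if holomorphic_on_imp_continuous_on)
    have "(\<lambda>z. ennreal (cmod (Q (if z \<in> W then s j z else 0)) *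
        (cmod ((if z \<in> W then s j z else 0) / (of_nat d * (z - c))))\<^sup>2) * indicator W z) \<in> borel_measurable borel"
      by measurable
    also have "(\<lambda>z. ennreal (cmod (Q (if z \<in> W then s j z else 0)) *
        (cmod ((if z \<in> W then s j z else 0) / (of_nat d * (z - c))))\<^sup>2) * indicator W z) =
       (\<lambda>z. ennreal (cmod (Q (s j z)) * (cmod (s' j z))\<^sup>2) * indicator W z)"
      by (auto simp: fun_eq_iff indicator_def s'_def)
    finally show "(\<lambda>z. ennreal (cmod (Q (s j z)) * (cmod (s' j z))\<^sup>2) * indicator W z) \<in> borel_measurable lborel"
      by simp
  qed
  also have "\<dots> = (\<Sum>j<d. \<integral>\<^sup>+z. ennreal (cmod (Q z)) * indicator (s j ` W) z \<partial>lborel)"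
  proof (intro sum.cong[OF refl] nn_integral_conformal_change_of_variables[OF W op der inj])
    fix j
    have "(\<integral>\<^sup>+z. ennreal (cmod (Q z)) * indicator (s j ` W) z \<partial>lborel)
       \<le> (\<integral>\<^sup>+z. ennreal (cmod (Q z)) * indicator P z \<partial>lborel)"
      using sub by (intro nn_integral_mono mult_left_mono indicator_leI) (auto simp: indicator_def)
    then show "(\<integral>\<^sup>+z. ennreal (cmod (Q z)) * indicator (s j ` W) z \<partial>lborel) < \<infinity>"
      using fin by (rule order.strict_trans1)
  qed auto
  also have "\<dots> = (\<integral>\<^sup>+z. (\<Sum>j<d. ennreal (cmod (Q z)) * indicator (s j ` W) z) \<partial>lborel)"
    by (intro nn_integral_sum[symmetric]) measurable
  also have "\<dots> \<le> (\<integral>\<^sup>+z. ennreal (cmod (Q z)) * indicator P z \<partial>lborel)"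
    using sum_le by (intro nn_integral_mono) (auto simp: sum_distrib_left[symmetric] intro!: mult_left_mono)
  finally show ?thesis .
qed

section \<open>Quadratic differentials with poles along a cycle\<close>

text \<open>The coefficient of a quadratic differential whose poles lie at \<open>a 0, \<dots>, a (n - 1)\<close>. All the double
  poles get the same coefficient, because pushing forward by a map preserves the coefficient of
  \<open>dz\<^sup>2 / (z - a)\<^sup>2\<close>.\<close>

definition polar_part :: "nat \<Rightarrow> (nat \<Rightarrow> complex) \<Rightarrow> complex \<Rightarrow> (nat \<Rightarrow> complex) \<Rightarrow> complex \<Rightarrow> complex" where
  "polar_part n a \<alpha> \<rho> z = (\<Sum>k<n. \<alpha> / (z - a k)\<^sup>2 + \<rho> k / (z - a k))"

lemma sum_cyclic_shift:
  fixes g :: "nat \<Rightarrow> 'a::ab_group_add"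
  assumes "g n = g 0" shows "(\<Sum>k<n. g (Suc k)) = (\<Sum>k<n. g k)"
  using sum.lessThan_Suc_shift[of g n] assms by (simp add: algebra_simps)

text \<open>The partial fraction decomposition that splits the push-forward of a polar part with pole \<open>a\<close>, where
  \<open>A = a ^ d\<close>, into a polar part at the image of \<open>a\<close>, whose difference from the variable is \<open>t\<close>, and
  a simple pole at the critical value, whose difference from the variable is \<open>y\<close>.\<close>

lemma pushforward_local_identity:
  fixes A t y d \<alpha> r :: complex
  assumes "A \<noteq> 0" "t \<noteq> 0" "y \<noteq> 0" "d \<noteq> 0" and yA: "y = t + A"
 shows "(\<alpha> * (d * y * (t + d * A) / t\<^sup>2) + (\<alpha> * (d - 1) + d * A * r) * (d * y / t)) / (d * y)\<^sup>2 = \<alpha> / t\<^sup>2 + r / t - r / y"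
proof -
  have "(\<alpha> * (d * y * (t + d * A) / t\<^sup>2) + (\<alpha> * (d - 1) + d * A * r) * (d * y / t)) / (d * y)\<^sup>2
     = (\<alpha> * (t + d * A) + (\<alpha> * (d - 1) + d * A * r) * t) / (d * y * t\<^sup>2)"
    using assms(1-4) by (simp add: field_simps power2_eq_square)
  also have "\<alpha> * (t + d * A) + (\<alpha> * (d - 1) + d * A * r) * t = d * (\<alpha> * y + r * A * t)"
    by (simp add: yA algebra_simps)
  also have "d * (\<alpha> * y + r * A * t) / (d * y * t\<^sup>2) = \<alpha> / t\<^sup>2 + r * A / (y * t)"
    using assms(1-4) by (simp add: field_simps power2_eq_square)
  also have "r * A / (y * t) = r / t - r / y"
    using assms(1-4) by (simp add: field_simps yA)
  finally show ?thesis by simp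
qed

text \<open>Pushing forward moves the pole \<open>a k\<close> to \<open>a (Suc k)\<close> and changes its residue as in the recursion for
  \<open>\<rho>\<close>. The price is a simple pole at the critical value \<open>c\<close>; the poles coming from the different
  \<open>k\<close> cancel there because the residues add up to zero.\<close>

lemma pushforward_polar_part:
  assumes d: "d \<ge> 2"
    and a: "\<And>k. a k \<noteq> 0" "\<And>k. a (Suc k) = a k ^ d + c" "a n = a 0"
    and \<rho>: "\<And>k. \<rho> (Suc k) = \<rho> k / (of_nat d * a k ^ (d - 1)) - \<alpha> * of_nat (d - 1) / (of_nat d * a k ^ d)"
      "\<rho> n = \<rho> 0" "(\<Sum>k<n. \<rho> k) = 0"
    and s: "s \<noteq> 0" "\<And>k. k < n \<Longrightarrow> s ^ d + c \<noteq> a k"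
  shows "(\<Sum>j<d. polar_part n a \<alpha> \<rho> (unity_root d ^ j * s) * (unity_root d ^ j * s / (of_nat d * s ^ d))\<^sup>2)
       = polar_part n a \<alpha> \<rho> (s ^ d + c)"
proof -
  define z where "z = s ^ d + c"
  let ?w = "\<lambda>j. unity_root d ^ j * s"
  have ne: "z \<noteq> a (Suc k)" if "k < n" for k
    using s(2)[of "Suc k"] s(2)[of 0] that a(3) by (cases "Suc k = n") (auto simp: z_def)
  have term_eq: "(\<Sum>j<d. (\<alpha> / (?w j - a k)\<^sup>2 + \<rho> k / (?w j - a k)) * (?w j / (of_nat d * s ^ d))\<^sup>2)
     = \<alpha> / (z - a (Suc k))\<^sup>2 + \<rho> (Suc k) / (z - a (Suc k)) - \<rho> (Suc k) / (z - c)" if k: "k < n" for k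
  proof -
    define A y t where "A = a k ^ d" and "y = s ^ d" and "t = z - a (Suc k)"
    have yA: "y = t + A" by (simp add: A_def y_def t_def z_def a(2))
    have t0: "t \<noteq> 0" using ne[OF k] by (simp add: t_def)
    have A0: "A \<noteq> 0" "y \<noteq> 0" using a(1)[of k] s d by (auto simp: A_def y_def)
    have cond: "a k ^ d \<noteq> s ^ d" using yA t0 by (auto simp: A_def y_def)
    have Aa: "a k ^ (d - 1) = A / a k"
      using a(1)[of k] d by (simp add: A_def power_diff)
    have dd: "of_nat (d - 1) = (of_nat d - 1 :: complex)" using d by (simp add: of_nat_diff)
    have "(\<Sum>j<d. (\<alpha> / (?w j - a k)\<^sup>2 + \<rho> k / (?w j - a k)) * (?w j / (of_nat d * s ^ d))\<^sup>2)
      = (\<alpha> * (\<Sum>j<d. (?w j)\<^sup>2 / (?w j - a k)\<^sup>2) + \<rho> k * (\<Sum>j<d. (?w j)\<^sup>2 / (?w j - a k))) / (of_nat d * y)\<^sup>2"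
    proof -
      have "(\<alpha> / X\<^sup>2 + \<rho> k / X) * (w / D)\<^sup>2 = (\<alpha> * (w\<^sup>2 / X\<^sup>2) + \<rho> k * (w\<^sup>2 / X)) / D\<^sup>2" for X w D :: complex
        by (simp add: power_divide add_divide_distrib distrib_right)
      then show ?thesis
        unfolding y_def by (simp only: sum_divide_distrib[symmetric] sum.distrib sum_distrib_left)
    qed
    also have "\<dots> = (\<alpha> * (of_nat d * y * (t + of_nat d * A) / t\<^sup>2) + \<rho> k * (of_nat d * a k * y / t)) / (of_nat d * y)\<^sup>2"
      unfolding sum_over_roots_simple_pole[OF d s(1) cond] sum_over_roots_double_pole[OF d s(1) cond]
      using yA by (simp add: y_def A_def)
    also have "\<dots> = \<alpha> / t\<^sup>2 + \<rho> (Suc k) / t - \<rho> (Suc k) / y"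
    proof -
      have d0: "(of_nat d :: complex) \<noteq> 0" using d by simp
      have "\<rho> (Suc k) = (\<rho> k * a k - \<alpha> * (of_nat d - 1)) / (of_nat d * A)"
        unfolding \<rho>(1) Aa dd using A0 a(1)[of k] by (simp add: A_def[symmetric] diff_divide_distrib)
      then have R: "\<rho> k * (of_nat d * a k * y / t) = (\<alpha> * (of_nat d - 1) + of_nat d * A * \<rho> (Suc k)) * (of_nat d * y / t)"
        using A0 d0 by (simp add: field_simps)
      show ?thesis
        unfolding R using pushforward_local_identity[of A t y "of_nat d"] A0 t0 d0 yA by simp
    qed
    finally show ?thesis by (simp add: t_def y_def z_def)
  qed
  have "(\<Sum>j<d. polar_part n a \<alpha> \<rho> (?w j) * (?w j / (of_nat d * s ^ d))\<^sup>2)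
     = (\<Sum>k<n. \<Sum>j<d. (\<alpha> / (?w j - a k)\<^sup>2 + \<rho> k / (?w j - a k)) * (?w j / (of_nat d * s ^ d))\<^sup>2)"
    unfolding polar_part_def sum_distrib_right by (rule sum.swap)
  also have "\<dots> = (\<Sum>k<n. \<alpha> / (z - a (Suc k))\<^sup>2 + \<rho> (Suc k) / (z - a (Suc k)) - \<rho> (Suc k) / (z - c))"
    using term_eq by (intro sum.cong) auto
  also have "\<dots> = (\<Sum>k<n. \<alpha> / (z - a k)\<^sup>2 + \<rho> k / (z - a k) - \<rho> k / (z - c))"
    by (rule sum_cyclic_shift[of "\<lambda>k. \<alpha> / (z - a k)\<^sup>2 + \<rho> k / (z - a k) - \<rho> k / (z - c)"])
       (simp add: a \<rho>)
  also have "\<dots> = polar_part n a \<alpha> \<rho> z"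
    using \<rho>(3) by (simp add: polar_part_def sum_subtractf sum_divide_distrib[symmetric])
  finally show ?thesis by (simp add: z_def)
qed

text \<open>After clearing denominators the sum is an entire function that vanishes on an open set, hence
  everywhere. At \<open>a k\<close> only the \<open>k\<close>-th summand survives.\<close>

lemma residues_zero_if_sum_vanishes:
  fixes a :: "nat \<Rightarrow> complex" and b :: "nat \<Rightarrow> complex \<Rightarrow> complex"
  assumes U: "open U" "U \<noteq> {}" "\<And>k. k < n \<Longrightarrow> a k \<notin> U" and inj: "inj_on a {..<n}"
    and hol: "\<And>k. k < n \<Longrightarrow> b k holomorphic_on UNIV"
    and zero: "\<And>z. z \<in> U \<Longrightarrow> (\<Sum>k<n. b k z / (z - a k) ^ m) = 0"
    and k: "k < n" and m: "m \<ge> 1"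
  shows "b k (a k) = 0"
proof -
  let ?g = "\<lambda>z. \<Sum>k<n. b k z * (\<Prod>j\<in>{..<n}-{k}. (z - a j) ^ m)"
  have zeroU: "?g z = 0" if "z \<in> U" for z
  proof -
    have "?g z = (\<Sum>k<n. b k z / (z - a k) ^ m * (\<Prod>j<n. (z - a j) ^ m))"
    proof (intro sum.cong refl)
      fix k assume "k \<in> {..<n}"
      moreover from this have "z - a k \<noteq> 0" using U that by auto
      ultimately show "b k z * (\<Prod>j\<in>{..<n}-{k}. (z - a j) ^ m) = b k z / (z - a k) ^ m * (\<Prod>j<n. (z - a j) ^ m)"
        by (subst prod.remove[OF finite_lessThan, of k n]) auto
    qed
    also have "\<dots> = 0" using zero[OF that] by (simp only: sum_distrib_right[symmetric] mult_zero_left)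
    finally show ?thesis .
  qed
  have "?g (a k) = 0"
    by (rule analytic_continuation_open[of U UNIV ?g "\<lambda>_. 0"])
       (use U hol zeroU in \<open>auto intro!: holomorphic_intros\<close>)
  moreover have "?g (a k) = b k (a k) * (\<Prod>j\<in>{..<n}-{k}. (a k - a j) ^ m)"
  proof -
    have "?g (a k) = (\<Sum>i<n. if i = k then b k (a k) * (\<Prod>j\<in>{..<n}-{k}. (a k - a j) ^ m) else 0)"
    proof (intro sum.cong refl)
      fix i assume "i \<in> {..<n}"
      have "(\<Prod>j\<in>{..<n}-{i}. (a k - a j) ^ m) = 0" if "i \<noteq> k"
        using k that m by (intro prod_zero) (auto intro!: bexI[of _ k])
      then show "b i (a k) * (\<Prod>j\<in>{..<n}-{i}. (a k - a j) ^ m) =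
        (if i = k then b k (a k) * (\<Prod>j\<in>{..<n}-{k}. (a k - a j) ^ m) else 0)" by simp
    qed
    then show ?thesis using k by simp
  qed
  moreover have "(\<Prod>j\<in>{..<n}-{k}. (a k - a j) ^ m) \<noteq> 0"
    using inj k by (auto simp: inj_on_def)
  ultimately show ?thesis by simp
qed

lemma polar_part_zero_imp_coeffs_zero:
  assumes U: "open U" "U \<noteq> {}" "\<And>k. k < n \<Longrightarrow> a k \<notin> U" and inj: "inj_on a {..<n}"
    and zero: "\<And>z. z \<in> U \<Longrightarrow> polar_part n a \<alpha> \<rho> z = 0" and k: "k < n"
  shows "\<alpha> = 0" "\<rho> k = 0"
proof -
  have "(\<Sum>k<n. (\<alpha> + \<rho> k * (z - a k)) / (z - a k) ^ 2) = polar_part n a \<alpha> \<rho> z" if "z \<in> U" for z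
    unfolding polar_part_def
  proof (intro sum.cong refl)
    fix k assume "k \<in> {..<n}"
    with U that have "z - a k \<noteq> 0" by auto
    then show "(\<alpha> + \<rho> k * (z - a k)) / (z - a k) ^ 2 = \<alpha> / (z - a k)\<^sup>2 + \<rho> k / (z - a k)"
      by (simp add: add_divide_distrib power2_eq_square)
  qed
  then have "(\<lambda>z. \<alpha> + \<rho> k * (z - a k)) (a k) = 0"
    using zero by (intro residues_zero_if_sum_vanishes[OF U inj _ _ k, where m = 2 and b = "\<lambda>k z. \<alpha> + \<rho> k * (z - a k)"]
       holomorphic_intros) auto
  then show \<alpha>: "\<alpha> = 0" by simp
  then have "(\<lambda>z. \<rho> k) (a k) = 0"
    using zero by (intro residues_zero_if_sum_vanishes[OF U inj _ _ k, where m = 1 and b = "\<lambda>k z. \<rho> k"]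
       holomorphic_intros) (auto simp: polar_part_def)
  then show "\<rho> k = 0" .
qed

text \<open>The inductive step writes the error for the exponent \<open>d + 1\<close> as \<open>w\<close> times the error for \<open>d\<close>, plus
  a term that is quadratic in \<open>w - a\<close>.\<close>

lemma power_second_order_bound:
  fixes a :: complex
  shows "\<exists>M\<ge>0. \<forall>w. cmod (w - a) \<le> 1 \<longrightarrow>
    cmod (w ^ d - a ^ d - of_nat d * a ^ (d - 1) * (w - a)) \<le> M * (cmod (w - a))\<^sup>2"
proof (induction d)
  case 0
  show ?case by (intro exI[of _ 0]) auto
next
  case (Suc d)
  then obtain M where M: "M \<ge> 0" "\<And>w. cmod (w - a) \<le> 1 \<Longrightarrow>
    cmod (w ^ d - a ^ d - of_nat d * a ^ (d - 1) * (w - a)) \<le> M * (cmod (w - a))\<^sup>2" by blast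
  define N where "N = (cmod a + 1) * M + cmod (of_nat d * a ^ (d - 1))"
  have "cmod (w ^ Suc d - a ^ Suc d - of_nat (Suc d) * a ^ (Suc d - 1) * (w - a)) \<le> N * (cmod (w - a))\<^sup>2"
    if w: "cmod (w - a) \<le> 1" for w
  proof -
    define b where "b = of_nat d * a ^ (d - Suc 0)"
    have "of_nat d * a ^ d = a * b" by (cases d) (auto simp: b_def)
    then have "w ^ Suc d - a ^ Suc d - of_nat (Suc d) * a ^ (Suc d - 1) * (w - a) =
       w * (w ^ d - a ^ d - of_nat d * a ^ (d - 1) * (w - a)) + of_nat d * a ^ (d - 1) * (w - a)\<^sup>2"
      by (simp add: b_def[symmetric] algebra_simps power2_eq_square)
    also have "cmod \<dots> \<le> cmod w * cmod (w ^ d - a ^ d - of_nat d * a ^ (d - 1) * (w - a))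
         + cmod (of_nat d * a ^ (d - 1)) * (cmod (w - a))\<^sup>2"
      by (metis norm_mult norm_power norm_triangle_ineq)
    also have "\<dots> \<le> (cmod a + 1) * (M * (cmod (w - a))\<^sup>2) + cmod (of_nat d * a ^ (d - 1)) * (cmod (w - a))\<^sup>2"
    proof (intro add_right_mono mult_mono M(2) w)
      show "cmod w \<le> cmod a + 1" using w norm_triangle_sub[of w a] by linarith
    qed auto
    finally show ?thesis by (simp add: N_def algebra_simps)
  qed
  then show ?case using M by (intro exI[of _ N]) (auto simp: N_def)
qed

section \<open>No invariant quadratic differential along an indifferent cycle\<close>

lemma emeasure_thin_annulus_le:
  fixes a :: complex
  assumes "0 \<le> \<delta>" "\<delta> \<le> 1" "0 \<le> r"
  shows "emeasure lborel (cball a r - ball a (r * (1 - \<delta>))) \<le> ennreal (2 * pi * r\<^sup>2 * \<delta>)"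
proof -
  have sub: "ball a (r * (1 - \<delta>)) \<subseteq> cball a r"
  proof -
    have "r * (1 - \<delta>) \<le> r * 1" using assms by (intro mult_left_mono) auto
    then show ?thesis by (auto simp: subset_iff)
  qed
  have nn: "0 \<le> r * (1 - \<delta>)" using assms by simp
  have "emeasure lborel (cball a r - ball a (r * (1 - \<delta>)))
      = emeasure lborel (cball a r) - emeasure lborel (ball a (r * (1 - \<delta>)))"
    using sub nn by (intro emeasure_Diff) (auto simp: emeasure_ball)
  also have "\<dots> = ennreal (pi * r\<^sup>2) - ennreal (pi * (r * (1 - \<delta>))\<^sup>2)"
    using nn assms by (simp add: emeasure_ball emeasure_cball eval_unit_ball_vol)
  also have "\<dots> = ennreal (pi * r\<^sup>2 - pi * (r * (1 - \<delta>))\<^sup>2)"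
    by (intro ennreal_minus) simp
  also have "\<dots> \<le> ennreal (2 * pi * r\<^sup>2 * \<delta>)"
  proof (intro ennreal_leI)
    have "2 * pi * r\<^sup>2 * \<delta> - (pi * r\<^sup>2 - pi * (r * (1 - \<delta>))\<^sup>2) = pi * (r * \<delta>)\<^sup>2"
      by (simp add: algebra_simps power2_eq_square)
    then show "pi * r\<^sup>2 - pi * (r * (1 - \<delta>))\<^sup>2 \<le> 2 * pi * r\<^sup>2 * \<delta>"
      by (smt (verit) mult_nonneg_nonneg pi_ge_zero zero_le_power2)
  qed
  finally show ?thesis .
qed

lemma zero_if_AE_zero_on_open:
  fixes Q :: "complex \<Rightarrow> complex"
  assumes "open U" "continuous_on U Q" "AE z in lborel. z \<in> U \<longrightarrow> Q z = 0" "z \<in> U"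
  shows "Q z = 0"
proof (rule ccontr)
  assume "Q z \<noteq> 0"
  define N where "N = U \<inter> Q -` (- {0})"
  have "open N"
    using continuous_open_preimage[OF assms(2,1), of "- {0}"] by (simp add: N_def open_Compl)
  moreover have "z \<in> N" using assms(4) \<open>Q z \<noteq> 0\<close> by (simp add: N_def)
  moreover have "N \<in> null_sets lborel"
    using assms(3) \<open>open N\<close> by (subst AE_iff_null_sets) (auto simp: N_def elim!: eventually_mono)
  then have "negligible N" by (simp add: negligible_iff_null_sets null_sets_completionI)
  ultimately show False using open_not_negligible by blast
qed

text \<open>By \<open>pushforward_polar_part\<close>, \<open>Q = polar_part n a \<alpha> \<rho>\<close> is invariant under push-forward. Let \<open>T\<close>
  be so large that the preimage of the disc of radius \<open>2 * T\<close> lies in the disc of radius \<open>T\<close>. If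
  \<open>Q\<close> were integrable, then the norm over the large disc would be at most that over the small one,
  so \<open>Q\<close> would vanish between them.

  To cope with the double poles, discs of radius \<open>\<epsilon> * r k\<close> around the points of the cycle are taken
  out of the large disc. As the multiplier has modulus 1, the \<open>r k\<close> can be chosen such that
  the derivative maps each of these discs onto the next one, all the way around the cycle. Up to the
  second-order term, the preimage then avoids the same discs; precisely, it avoids the discs of radius
  \<open>\<epsilon> * r k * (1 - \<epsilon> * C)\<close>. The annuli in between have area of order \<open>\<epsilon>\<^sup>3\<close> and \<open>|Q|\<close> is of order
  \<open>1 / \<epsilon>\<^sup>2\<close> on them, so their contribution disappears as \<open>\<epsilon>\<close> tends to 0.\<close>

lemma invariant_polar_part_trivial:
  fixes a \<rho> :: "nat \<Rightarrow> complex"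
  assumes d: "d \<ge> 2" and n: "n \<ge> 1"
    and a: "\<And>k. a k \<noteq> 0" "\<And>k. a (Suc k) = a k ^ d + c" "a n = a 0"
    and inj: "inj_on a {..<n}"
    and indiff: "(\<Prod>k<n. cmod (of_nat d * a k ^ (d - 1))) = 1"
    and \<rho>: "\<And>k. \<rho> (Suc k) = \<rho> k / (of_nat d * a k ^ (d - 1)) - \<alpha> * of_nat (d - 1) / (of_nat d * a k ^ d)"
      "\<rho> n = \<rho> 0" "(\<Sum>k<n. \<rho> k) = 0"
  shows "\<alpha> = 0" "\<rho> 0 = 0"
proof -
  let ?Q = "polar_part n a \<alpha> \<rho>"
  define r where "r = (\<lambda>k. \<Prod>i<k. cmod (of_nat d * a i ^ (d - 1)))"
  have r_pos: "r k > 0" for k using a(1) d by (auto simp: r_def intro!: prod_pos)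
  have r_Suc: "r (Suc k) = cmod (of_nat d * a k ^ (d - 1)) * r k" for k by (simp add: r_def)
  have r_n: "r n = r 0" using indiff by (simp add: r_def)
  have "\<forall>k. \<exists>M\<ge>0. \<forall>w. cmod (w - a k) \<le> 1 \<longrightarrow>
    cmod (w ^ d - a k ^ d - of_nat d * a k ^ (d - 1) * (w - a k)) \<le> M * (cmod (w - a k))\<^sup>2"
    using power_second_order_bound by blast
  then obtain M where M: "\<And>k. M k \<ge> 0" "\<And>k w. cmod (w - a k) \<le> 1 \<Longrightarrow>
    cmod (w ^ d - a k ^ d - of_nat d * a k ^ (d - 1) * (w - a k)) \<le> M k * (cmod (w - a k))\<^sup>2"
    by metis
  define C where "C = (\<Sum>k<n. M k * (r k)\<^sup>2 / r (Suc k))"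
  have C0: "C \<ge> 0" using M(1) r_pos by (auto simp: C_def less_imp_le intro!: sum_nonneg)
  have C: "M k * (r k)\<^sup>2 \<le> C * r (Suc k)" if "k < n" for k
  proof -
    have "M k * (r k)\<^sup>2 / r (Suc k) \<le> C" unfolding C_def
      using M(1) r_pos that by (intro member_le_sum) (auto simp: less_imp_le)
    then show ?thesis using r_pos[of "Suc k"] by (simp add: divide_le_eq)
  qed
  define T where "T = 3 + cmod c + (\<Sum>k<n. cmod (a k))"
  have T: "T \<ge> 3 + cmod c" unfolding T_def by (simp add: sum_nonneg)
  have aT: "cmod (a k) + 1 < T" if "k < n" for k
    using member_le_sum[of k "{..<n}" "\<lambda>k. cmod (a k)"] that unfolding T_def by (smt (verit) finite_lessThan lessThan_iff norm_ge_zero)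
  (* a disc so large that the preimage of its double is contained in it *)
  have escape: "cmod w < T" if "cmod (w ^ d + c) < 2 * T" for w
  proof (rule ccontr)
    assume "\<not> cmod w < T"
    then have w: "cmod w \<ge> T" by simp
    have "T * T \<le> cmod w * cmod w" using w T norm_ge_zero[of c] by (intro mult_mono) linarith+
    also have "\<dots> \<le> cmod w ^ d"
      using power_increasing[of 2 d "cmod w"] d w T norm_ge_zero[of c] by (simp add: power2_eq_square)
    also have "\<dots> = cmod ((w ^ d + c) - c)" by (simp add: norm_power)
    also have "\<dots> \<le> cmod (w ^ d + c) + cmod c" by (rule norm_triangle_ineq4)
    finally have "T * T < 2 * T + cmod c" using that by linarith
    moreover have "3 * T \<le> T * T" using T norm_ge_zero[of c] by (intro mult_right_mono) linarith+
    ultimately show False using T by linarith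
  qed
  define K where "K = (\<Sum>k<n. 4 * cmod \<alpha> / (r k)\<^sup>2 + 2 * cmod (\<rho> k) / r k)"
  define K' where "K' = (\<Sum>k<n. 2 * pi * C * K * (r k)\<^sup>2)"
  have K0: "K \<ge> 0" using r_pos by (auto simp: K_def less_imp_le intro!: sum_nonneg)
  have K'0: "K' \<ge> 0" using K0 C0 by (auto simp: K'_def intro!: sum_nonneg)
  define E where "E = ball (0::complex) (2 * T) - ball 0 T"
  have [measurable]: "?Q \<in> borel_measurable borel" unfolding polar_part_def by measurable
  have [measurable]: "E \<in> sets borel" by (simp add: E_def)
  define \<epsilon>0 where "\<epsilon>0 = 1 / (2 + 2 * C + (\<Sum>k<n. r k))"
  have S0: "(\<Sum>k<n. r k) \<ge> 0" using r_pos by (auto intro!: sum_nonneg simp: less_imp_le)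
  have \<epsilon>0: "\<epsilon>0 > 0" using S0 C0 by (auto simp: \<epsilon>0_def intro!: divide_pos_pos)
  have main: "(\<integral>\<^sup>+z. ennreal (cmod (?Q z)) * indicator E z \<partial>lborel) \<le> ennreal (K' * \<epsilon>)"
    if \<epsilon>: "0 < \<epsilon>" "\<epsilon> \<le> \<epsilon>0" for \<epsilon>
  proof -
    have e1: "\<epsilon> * (2 + 2 * C + (\<Sum>k<n. r k)) \<le> 1"
      using \<epsilon> S0 C0 by (simp add: \<epsilon>0_def le_divide_eq)
    then have e2: "2 * \<epsilon> + 2 * (\<epsilon> * C) + \<epsilon> * (\<Sum>k<n. r k) \<le> 1"
      by (simp add: algebra_simps)
    have eC: "0 \<le> \<epsilon> * C" "0 \<le> \<epsilon> * (\<Sum>k<n. r k)" using \<epsilon> S0 C0 by auto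
    have sm: "\<epsilon> \<le> 1" "\<epsilon> * C \<le> 1 / 2" using e2 eC \<epsilon>(1) by linarith+
    have sm2: "\<epsilon> * r k \<le> 1" if "k < n" for k
    proof -
      have "\<epsilon> * r k \<le> \<epsilon> * (\<Sum>k<n. r k)"
        using \<epsilon> r_pos that by (intro mult_left_mono member_le_sum) (auto simp: less_imp_le)
      then show ?thesis using e2 eC \<epsilon>(1) by linarith
    qed
    define D where "D = (\<lambda>k. cball (a k) (\<epsilon> * r k))"
    define D' where "D' = (\<lambda>k. ball (a k) (\<epsilon> * r k * (1 - \<epsilon> * C)))"
    define B where "B = ball 0 (2 * T) - (\<Union>k<n. D k)"
    define B' where "B' = ball 0 T - (\<Union>k<n. D k)"
    define P where "P = ball 0 T - (\<Union>k<n. D' k)"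
    have DT: "D k \<subseteq> ball 0 T" if "k < n" for k
    proof
      fix z assume "z \<in> D k"
      then have "cmod (z - a k) \<le> 1" using sm2[OF that] by (auto simp: D_def dist_norm norm_minus_commute)
      then show "z \<in> ball 0 T" using aT[OF that] norm_triangle_sub[of z "a k"] by simp
    qed
    have D'D: "D' k \<subseteq> D k" for k
    proof -
      have "\<epsilon> * r k * (1 - \<epsilon> * C) \<le> \<epsilon> * r k * 1"
        using \<epsilon> r_pos[of k] C0 by (intro mult_left_mono) auto
      then show ?thesis by (auto simp: D_def D'_def subset_iff)
    qed
    have [measurable]: "D k \<in> sets borel" "D' k \<in> sets borel" for k by (auto simp: D_def D'_def)
    have [measurable]: "B \<in> sets borel" "P \<in> sets borel" "B' \<in> sets borel"
      by (auto simp: B_def P_def B'_def)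
    have "closed (\<Union>k<n. D k)" by (auto simp: D_def)
    then have openB: "open B" unfolding B_def by (intro open_Diff) auto
    have bound: "cmod (?Q z) \<le> K / \<epsilon>\<^sup>2" if "z \<in> P" for z
    proof -
      have "cmod (?Q z) \<le> (\<Sum>k<n. cmod (\<alpha> / (z - a k)\<^sup>2 + \<rho> k / (z - a k)))"
        unfolding polar_part_def by (rule norm_sum)
      also have "\<dots> \<le> (\<Sum>k<n. (4 * cmod \<alpha> / (r k)\<^sup>2 + 2 * cmod (\<rho> k) / r k) / \<epsilon>\<^sup>2)"
      proof (intro sum_mono)
        fix k assume k: "k \<in> {..<n}"
        define x where "x = \<epsilon> * r k / 2"
        have x: "x > 0" using \<epsilon> r_pos by (simp add: x_def)
        have "\<epsilon> * r k * (1 / 2) \<le> \<epsilon> * r k * (1 - \<epsilon> * C)"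
          using \<epsilon> r_pos[of k] sm by (intro mult_left_mono) auto
        have zx: "cmod (z - a k) \<ge> x"
        proof -
          have "z \<notin> D' k" using that k by (auto simp: P_def)
          then show ?thesis
            using \<open>\<epsilon> * r k * (1 / 2) \<le> \<epsilon> * r k * (1 - \<epsilon> * C)\<close>
            by (simp add: D'_def dist_norm norm_minus_commute x_def)
        qed
        have "cmod (\<alpha> / (z - a k)\<^sup>2 + \<rho> k / (z - a k)) \<le> cmod \<alpha> / (cmod (z - a k))\<^sup>2 + cmod (\<rho> k) / cmod (z - a k)"
          by (rule order_trans[OF norm_triangle_ineq]) (simp add: norm_divide norm_power)
        also have "\<dots> \<le> cmod \<alpha> / x\<^sup>2 + cmod (\<rho> k) / x"
          using zx x by (intro add_mono divide_left_mono power_mono mult_pos_pos zero_less_power) auto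
        also have "\<dots> = 4 * cmod \<alpha> / (r k)\<^sup>2 / \<epsilon>\<^sup>2 + 2 * cmod (\<rho> k) / r k / \<epsilon>"
          by (simp add: x_def power_divide power_mult_distrib mult.commute)
        also have "2 * cmod (\<rho> k) / r k / \<epsilon> \<le> 2 * cmod (\<rho> k) / r k / \<epsilon>\<^sup>2"
          using \<epsilon> sm r_pos[of k] power_decreasing[of 1 2 \<epsilon>]
          by (intro divide_left_mono) (auto simp: less_imp_le)
        finally show "cmod (\<alpha> / (z - a k)\<^sup>2 + \<rho> k / (z - a k)) \<le> (4 * cmod \<alpha> / (r k)\<^sup>2 + 2 * cmod (\<rho> k) / r k) / \<epsilon>\<^sup>2"
          by (simp add: add_divide_distrib)
      qed
      also have "\<dots> = K / \<epsilon>\<^sup>2" by (simp add: K_def sum_divide_distrib)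
      finally show ?thesis .
    qed
    have fin: "(\<integral>\<^sup>+z. ennreal (cmod (?Q z)) * indicator P z \<partial>lborel) < \<infinity>"
    proof -
      have "(\<integral>\<^sup>+z. ennreal (cmod (?Q z)) * indicator P z \<partial>lborel)
         \<le> (\<integral>\<^sup>+z. ennreal (K / \<epsilon>\<^sup>2) * indicator (ball (0::complex) T) z \<partial>lborel)"
      proof (intro nn_integral_mono)
        fix z
        show "ennreal (cmod (?Q z)) * indicator P z \<le> ennreal (K / \<epsilon>\<^sup>2) * indicator (ball 0 T) z"
          using bound[of z] by (cases "z \<in> P") (simp_all add: ennreal_leI P_def)
      qed
      also have "\<dots> = ennreal (K / \<epsilon>\<^sup>2) * emeasure lborel (ball (0::complex) T)"
        by (rule nn_integral_cmult_indicator) simp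
      also have "\<dots> < \<infinity>"
        using T norm_ge_zero[of c] by (subst emeasure_ball) (auto simp: ennreal_mult_less_top simp del: norm_ge_zero)
      finally show ?thesis .
    qed
    have pre: "w \<in> P" if wB: "w ^ d + c \<in> B" for w
    proof -
      have "w \<notin> D' k" if k: "k < n" for k
      proof
        assume "w \<in> D' k"
        then have wk: "cmod (w - a k) < \<epsilon> * r k * (1 - \<epsilon> * C)" "cmod (w - a k) \<le> \<epsilon> * r k"
          using D'D[of k] by (auto simp: D'_def D_def dist_norm norm_minus_commute)
        have "cmod (w ^ d + c - a (Suc k)) = cmod ((w ^ d - a k ^ d - of_nat d * a k ^ (d - 1) * (w - a k)) + of_nat d * a k ^ (d - 1) * (w - a k))"
          by (simp add: a(2))
        also have "\<dots> \<le> M k * (cmod (w - a k))\<^sup>2 + cmod (of_nat d * a k ^ (d - 1)) * cmod (w - a k)"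
          using M(2)[of w k] wk(2) sm2[OF k]
          by (intro order_trans[OF norm_triangle_ineq] add_mono) (simp_all add: norm_mult)
        also have "\<dots> \<le> M k * (\<epsilon> * r k)\<^sup>2 + cmod (of_nat d * a k ^ (d - 1)) * (\<epsilon> * r k * (1 - \<epsilon> * C))"
          using wk M(1) by (intro add_mono mult_left_mono power_mono) auto
        also have "\<dots> = \<epsilon>\<^sup>2 * (M k * (r k)\<^sup>2) + \<epsilon> * r (Suc k) * (1 - \<epsilon> * C)"
          by (simp add: r_Suc power_mult_distrib mult_ac)
        also have "\<dots> \<le> \<epsilon>\<^sup>2 * (C * r (Suc k)) + \<epsilon> * r (Suc k) * (1 - \<epsilon> * C)"
          using C[OF k] by (intro add_right_mono mult_left_mono) auto
        also have "\<dots> = \<epsilon> * r (Suc k)" by (simp add: algebra_simps power2_eq_square)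
        finally have "w ^ d + c \<in> D (Suc k)" by (simp add: D_def dist_norm norm_minus_commute)
        moreover have "D (Suc k) \<subseteq> (\<Union>k<n. D k)"
        proof (cases "Suc k = n")
          case True
          then have "D (Suc k) = D 0" by (simp add: D_def a(3) r_n)
          then show ?thesis using n by (auto intro!: bexI[of _ 0])
        next
          case False then show ?thesis using k by (intro UN_upper) auto
        qed
        ultimately show False using wB by (auto simp: B_def)
      qed
      then show ?thesis using wB escape[of w] by (auto simp: P_def B_def)
    qed
    have "(\<integral>\<^sup>+z. ennreal (cmod (?Q z)) * indicator B z \<partial>lborel)
          \<le> (\<integral>\<^sup>+z. ennreal (cmod (?Q z)) * indicator P z \<partial>lborel)"
    proof (rule pushforward_L1_le[OF d openB _ _ pre fin])
      fix s assume s: "s ^ d + c \<in> B" "s \<noteq> 0"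
      have "s ^ d + c \<noteq> a k" if "k < n" for k
      proof
        assume "s ^ d + c = a k"
        moreover have "a k \<in> D k" using \<epsilon> r_pos[of k] by (simp add: D_def)
        ultimately show False using s that by (auto simp: B_def)
      qed
      from pushforward_polar_part[OF d a \<rho> s(2) this]
      show "?Q (s ^ d + c) = (\<Sum>j<d. ?Q (unity_root d ^ j * s) * (unity_root d ^ j * s / (of_nat d * s ^ d))\<^sup>2)"
        by simp
    qed auto
    also have "\<dots> \<le> (\<integral>\<^sup>+z. ennreal (cmod (?Q z)) * indicator B' z + (\<Sum>k<n. ennreal (K / \<epsilon>\<^sup>2) * indicator (D k - D' k) z) \<partial>lborel)"
    proof (intro nn_integral_mono)
      fix z
      show "ennreal (cmod (?Q z)) * indicator P z \<le>
         ennreal (cmod (?Q z)) * indicator B' z + (\<Sum>k<n. ennreal (K / \<epsilon>\<^sup>2) * indicator (D k - D' k) z)"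
      proof (cases "z \<in> P \<and> z \<notin> B'")
        case True
        then obtain k where k: "k < n" "z \<in> D k - D' k" by (auto simp: P_def B'_def)
        have "ennreal (cmod (?Q z)) * indicator P z \<le> ennreal (K / \<epsilon>\<^sup>2)"
          using bound[of z] True by (simp add: ennreal_leI)
        also have "\<dots> = ennreal (K / \<epsilon>\<^sup>2) * indicator (D k - D' k) z" using k by simp
        also have "\<dots> \<le> (\<Sum>k<n. ennreal (K / \<epsilon>\<^sup>2) * indicator (D k - D' k) z)"
          using k by (intro member_le_sum) auto
        finally show ?thesis by (simp add: add_increasing)
      next
        case False
        then have "indicator P z \<le> (indicator B' z :: ennreal)" by (auto simp: indicator_def)
        then show ?thesis by (intro add_increasing2 sum_nonneg mult_left_mono) auto
      qed
    qed
    also have "\<dots> = (\<integral>\<^sup>+z. ennreal (cmod (?Q z)) * indicator B' z \<partial>lborel) +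
        (\<Sum>k<n. ennreal (K / \<epsilon>\<^sup>2) * emeasure lborel (D k - D' k))"
    proof -
      have "(\<integral>\<^sup>+z. (\<Sum>k<n. ennreal (K / \<epsilon>\<^sup>2) * indicator (D k - D' k) z) \<partial>lborel)
        = (\<Sum>k<n. \<integral>\<^sup>+z. ennreal (K / \<epsilon>\<^sup>2) * indicator (D k - D' k) z \<partial>lborel)"
        by (intro nn_integral_sum) measurable
      also have "\<dots> = (\<Sum>k<n. ennreal (K / \<epsilon>\<^sup>2) * emeasure lborel (D k - D' k))"
        by (intro sum.cong refl nn_integral_cmult_indicator) measurable
      finally have *: "(\<integral>\<^sup>+z. (\<Sum>k<n. ennreal (K / \<epsilon>\<^sup>2) * indicator (D k - D' k) z) \<partial>lborel)
        = (\<Sum>k<n. ennreal (K / \<epsilon>\<^sup>2) * emeasure lborel (D k - D' k))" .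
      have m1: "(\<lambda>z. ennreal (cmod (?Q z)) * indicator B' z) \<in> borel_measurable lborel" by measurable
      have m2: "(\<lambda>z. \<Sum>k<n. ennreal (K / \<epsilon>\<^sup>2) * indicator (D k - D' k) z) \<in> borel_measurable lborel"
        by measurable
      show ?thesis unfolding nn_integral_add[OF m1 m2] * ..
    qed
    also have "(\<Sum>k<n. ennreal (K / \<epsilon>\<^sup>2) * emeasure lborel (D k - D' k)) \<le> (\<Sum>k<n. ennreal (2 * pi * C * K * (r k)\<^sup>2 * \<epsilon>))"
    proof (intro sum_mono)
      fix k
      have "ennreal (K / \<epsilon>\<^sup>2) * emeasure lborel (D k - D' k)
         \<le> ennreal (K / \<epsilon>\<^sup>2) * ennreal (2 * pi * (\<epsilon> * r k)\<^sup>2 * (\<epsilon> * C))"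
        unfolding D_def D'_def using \<epsilon> C0 sm r_pos[of k]
        by (intro mult_left_mono emeasure_thin_annulus_le) auto
      also have "\<dots> = ennreal (K / \<epsilon>\<^sup>2 * (2 * pi * (\<epsilon> * r k)\<^sup>2 * (\<epsilon> * C)))"
        using K0 \<epsilon> C0 by (intro ennreal_mult[symmetric]) auto
      also have "K / \<epsilon>\<^sup>2 * (2 * pi * (\<epsilon> * r k)\<^sup>2 * (\<epsilon> * C)) = 2 * pi * C * K * (r k)\<^sup>2 * \<epsilon>"
        using \<epsilon> by (simp add: field_simps power2_eq_square)
      finally show "ennreal (K / \<epsilon>\<^sup>2) * emeasure lborel (D k - D' k) \<le> ennreal (2 * pi * C * K * (r k)\<^sup>2 * \<epsilon>)" .
    qed
    also have "(\<Sum>k<n. ennreal (2 * pi * C * K * (r k)\<^sup>2 * \<epsilon>)) = ennreal (K' * \<epsilon>)"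
      using K0 C0 \<epsilon> by (subst sum_ennreal) (auto simp: K'_def sum_distrib_right)
    finally have up: "(\<integral>\<^sup>+z. ennreal (cmod (?Q z)) * indicator B z \<partial>lborel)
       \<le> (\<integral>\<^sup>+z. ennreal (cmod (?Q z)) * indicator B' z \<partial>lborel) + ennreal (K' * \<epsilon>)"
      by (simp add: add_left_mono)
    have "(\<integral>\<^sup>+z. ennreal (cmod (?Q z)) * indicator B' z \<partial>lborel) + (\<integral>\<^sup>+z. ennreal (cmod (?Q z)) * indicator E z \<partial>lborel)
       = (\<integral>\<^sup>+z. ennreal (cmod (?Q z)) * indicator B' z + ennreal (cmod (?Q z)) * indicator E z \<partial>lborel)"
      by (intro nn_integral_add[symmetric]) measurable
    also have "\<dots> \<le> (\<integral>\<^sup>+z. ennreal (cmod (?Q z)) * indicator B z \<partial>lborel)"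
    proof (intro nn_integral_mono)
      fix z
      have "indicator B' z + indicator E z \<le> (indicator B z :: ennreal)"
      proof -
        have "cmod z < 2 * T" if "cmod z < T" using that norm_ge_zero[of z] by linarith
        moreover have "cmod z < T" if "z \<in> D k" "k < n" for k using DT[OF that(2)] that(1) by auto
        ultimately show ?thesis by (auto simp: indicator_def B_def B'_def E_def)
      qed
      then show "ennreal (cmod (?Q z)) * indicator B' z + ennreal (cmod (?Q z)) * indicator E z \<le> ennreal (cmod (?Q z)) * indicator B z"
        by (metis distrib_left mult_left_mono zero_le)
    qed
    also note up
    finally have "(\<integral>\<^sup>+z. ennreal (cmod (?Q z)) * indicator B' z \<partial>lborel) + (\<integral>\<^sup>+z. ennreal (cmod (?Q z)) * indicator E z \<partial>lborel)
       \<le> (\<integral>\<^sup>+z. ennreal (cmod (?Q z)) * indicator B' z \<partial>lborel) + ennreal (K' * \<epsilon>)" .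
    moreover have "(\<integral>\<^sup>+z. ennreal (cmod (?Q z)) * indicator B' z \<partial>lborel) < \<infinity>"
    proof (rule order.strict_trans1[OF _ fin], intro nn_integral_mono mult_left_mono)
      fix z show "indicator B' z \<le> (indicator P z :: ennreal)"
        using D'D by (auto simp: indicator_def B'_def P_def)
    qed auto
    ultimately show ?thesis by (subst (asm) ennreal_add_left_cancel_le) auto
  qed
  have "(\<integral>\<^sup>+z. ennreal (cmod (?Q z)) * indicator E z \<partial>lborel) = 0"
  proof (rule ccontr)
    let ?I = "\<integral>\<^sup>+z. ennreal (cmod (?Q z)) * indicator E z \<partial>lborel"
    assume "?I \<noteq> 0"
    moreover have "?I < \<infinity>" using main[OF \<epsilon>0 order_refl] by (simp add: order.strict_trans1)
    ultimately obtain x where x: "?I = ennreal x" "x > 0"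
      by (cases ?I rule: ennreal_cases) (auto simp: less_le)
    define \<epsilon> where "\<epsilon> = min \<epsilon>0 (x / (2 * (K' + 1)))"
    have e: "0 < \<epsilon>" "\<epsilon> \<le> \<epsilon>0" using \<epsilon>0 x K'0 by (auto simp: \<epsilon>_def)
    have "x \<le> K' * \<epsilon>" using main[OF e] x K'0 e by (simp add: ennreal_le_iff)
    also have "\<dots> \<le> (K' + 1) * (x / (2 * (K' + 1)))"
      using K'0 e by (intro mult_mono) (auto simp: \<epsilon>_def)
    also have "\<dots> = x / 2"
    proof -
      have "K' + 1 \<noteq> 0" using K'0 by linarith
      then show ?thesis by (metis nonzero_mult_divide_mult_cancel_left times_divide_eq_right mult.commute)
    qed
    finally show False using x by simp
  qed
  then have AE: "AE z in lborel. ennreal (cmod (?Q z)) * indicator E z = 0"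
    by (subst (asm) nn_integral_0_iff_AE) auto
  define U where "U = ball (0::complex) (2 * T) - cball 0 T"
  have aU: "a k \<notin> U" if "k < n" for k using aT[OF that] by (simp add: U_def)
  have QU: "?Q z = 0" if "z \<in> U" for z
  proof (rule zero_if_AE_zero_on_open[OF _ _ _ that])
    show "continuous_on U ?Q" unfolding polar_part_def using aU
      by (intro continuous_intros) auto
    show "AE z in lborel. z \<in> U \<longrightarrow> ?Q z = 0"
      using AE by eventually_elim (auto simp: U_def E_def indicator_def split: if_splits)
  qed (simp add: U_def open_Diff)
  have "of_real (3 * T / 2) \<in> U"
    using T norm_ge_zero[of c] by (simp add: U_def norm_divide norm_mult del: norm_ge_zero)
  then have "U \<noteq> {}" by blast
  moreover have "open U" by (simp add: U_def open_Diff)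
  ultimately show "\<alpha> = 0" "\<rho> 0 = 0"
    using polar_part_zero_imp_coeffs_zero[OF _ _ aU inj QU, of 0] n by simp_all
qed

section \<open>Transversality\<close>

text \<open>A cyclic solution \<open>v\<close> of this recursion is the velocity of the cycle \<open>a\<close> when \<open>c\<close> moves with unit
  speed. The recursions for \<open>\<rho>\<close> and \<open>v\<close> are dual to each other: the increments of \<open>\<rho> k * v k\<close> add up
  to 0 around the cycle, and evaluating them by the recursions gives the identity.\<close>

lemma cyclic_velocity_sum:
  fixes a \<rho> v :: "nat \<Rightarrow> complex"
  assumes d: "d \<ge> 2" and a0: "\<And>k. a k \<noteq> 0"
    and \<rho>: "\<And>k. \<rho> (Suc k) = \<rho> k / (of_nat d * a k ^ (d - 1)) - \<alpha> * of_nat (d - 1) / (of_nat d * a k ^ d)"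
      "\<rho> n = \<rho> 0"
    and v: "\<And>k. v (Suc k) = of_nat d * a k ^ (d - 1) * v k + 1" "v n = v 0"
  shows "(\<Sum>k<n. \<rho> k) = \<alpha> * of_nat (d - 1) * (\<Sum>k<n. v k / a k)"
proof -
  have step: "\<rho> (Suc k) * v (Suc k) - \<rho> k * v k = \<rho> (Suc k) - \<alpha> * of_nat (d - 1) * (v k / a k)" for k
  proof -
    define m where "m = of_nat d * a k ^ (d - 1)"
    have m0: "m \<noteq> 0" using d a0[of k] by (simp add: m_def)
    have "a k ^ d = a k ^ (d - 1) * a k" using d power_minus_mult[of d "a k"] by simp
    then have m: "of_nat d * a k ^ d = m * a k" by (simp add: m_def)
    have gen: "(r / m - X / (m * b)) * m = r - X / b" if "b \<noteq> 0" for r X b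
      using m0 that by (simp add: left_diff_distrib)
    have "\<rho> (Suc k) * m = \<rho> k - \<alpha> * of_nat (d - 1) / a k"
      unfolding \<rho>(1)[of k] m m_def[symmetric] by (rule gen[OF a0])
    then have "\<rho> (Suc k) * m * v k = \<rho> k * v k - \<alpha> * of_nat (d - 1) * (v k / a k)"
      by (simp add: left_diff_distrib)
    then show ?thesis unfolding v(1)[of k] m_def[symmetric] by (simp add: algebra_simps)
  qed
  have "0 = (\<Sum>k<n. \<rho> (Suc k) * v (Suc k) - \<rho> k * v k)"
    by (subst sum_lessThan_telescope[of "\<lambda>k. \<rho> k * v k"]) (simp only: \<rho>(2) v(2) diff_self)
  also have "\<dots> = (\<Sum>k<n. \<rho> (Suc k)) - \<alpha> * of_nat (d - 1) * (\<Sum>k<n. v k / a k)"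
    unfolding step by (simp add: sum_subtractf sum_distrib_left)
  also have "(\<Sum>k<n. \<rho> (Suc k)) = (\<Sum>k<n. \<rho> k)" by (rule sum_cyclic_shift) (rule \<rho>)
  finally show ?thesis by simp
qed

lemma cycle_nonzero:
  fixes a :: "nat \<Rightarrow> complex"
  assumes d: "d \<ge> 2" and n: "n \<ge> 1"
    and a: "\<And>k. a (Suc k) = a k ^ d + c" "a n = a 0"
    and mult: "(\<Prod>k<n. of_nat d * a k ^ (d - 1)) \<noteq> (0::complex)"
  shows "a k \<noteq> 0"
proof (induction k rule: less_induct)
  case (less k)
  show ?case
  proof (cases "k < n")
    case True
    then have "of_nat d * a k ^ (d - 1) \<noteq> 0" using mult by (simp add: prod_zero_iff)
    then show ?thesis using d by auto
  next
    case False
    have "a (n + j) = a j" for j by (induction j) (simp_all add: a)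
    from this[of "k - n"] False have "a k = a (k - n)" by simp
    then show ?thesis using less[of "k - n"] False n by simp
  qed
qed

text \<open>For multiplier 1 the recursion for simple poles alone (\<open>\<alpha> = 0\<close>) has a nonzero cyclic solution. If
  the cycle could be followed to first order in \<open>c\<close>, the quadratic differential given by this solution
  would be invariant.\<close>

lemma parabolic_cycle_no_cyclic_velocity:
  fixes a v :: "nat \<Rightarrow> complex"
  assumes d: "d \<ge> 2" and n: "n \<ge> 1"
    and a: "\<And>k. a (Suc k) = a k ^ d + c" "a n = a 0" and inj: "inj_on a {..<n}"
    and mult: "(\<Prod>k<n. of_nat d * a k ^ (d - 1)) = (1::complex)"
    and v: "\<And>k. v (Suc k) = of_nat d * a k ^ (d - 1) * v k + 1"
  shows "v n \<noteq> v 0"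
proof
  assume vn: "v n = v 0"
  have a0: "a k \<noteq> 0" for k by (rule cycle_nonzero[OF d n a]) (simp only: mult one_neq_zero not_False_eq_True)
  define \<rho> where "\<rho> = (\<lambda>k. 1 / (\<Prod>i<k. of_nat d * a i ^ (d - 1)))"
  have \<rho>: "\<rho> (Suc k) = \<rho> k / (of_nat d * a k ^ (d - 1)) - 0 * of_nat (d - 1) / (of_nat d * a k ^ d)" for k
    by (simp add: \<rho>_def)
  have \<rho>n: "\<rho> n = \<rho> 0" using mult by (simp add: \<rho>_def)
  have sum0: "(\<Sum>k<n. \<rho> k) = 0" using cyclic_velocity_sum[OF d a0 \<rho> \<rho>n v vn] by simp
  have "(\<Prod>k<n. cmod (of_nat d * a k ^ (d - 1))) = 1"
    unfolding prod_norm mult by simp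
  then have "\<rho> 0 = 0"
    by (rule invariant_polar_part_trivial(2)[OF d n a0 a inj _ \<rho> \<rho>n sum0])
  then show False by (simp add: \<rho>_def)
qed

text \<open>The sum is, up to the factor \<open>d - 1\<close>, the logarithmic derivative of the multiplier
  \<open>\<Prod> d * a k ^ (d - 1)\<close> with respect to \<open>c\<close>. If it were zero, the quadratic differential with double
  poles along the cycle (\<open>\<alpha> = 1\<close>) would be invariant.\<close>

lemma indifferent_cycle_multiplier_velocity:
  fixes a v :: "nat \<Rightarrow> complex"
  assumes d: "d \<ge> 2" and n: "n \<ge> 1"
    and a: "\<And>k. a (Suc k) = a k ^ d + c" "a n = a 0" and inj: "inj_on a {..<n}"
    and mult: "cmod (\<Prod>k<n. of_nat d * a k ^ (d - 1)) = 1" "(\<Prod>k<n. of_nat d * a k ^ (d - 1)) \<noteq> 1"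
    and v: "\<And>k. v (Suc k) = of_nat d * a k ^ (d - 1) * v k + 1" "v n = v 0"
  shows "(\<Sum>k<n. v k / a k) \<noteq> 0"
proof
  assume S: "(\<Sum>k<n. v k / a k) = 0"
  define m where "m = (\<lambda>k. of_nat d * a k ^ (d - 1))"
  have nz: "(\<Prod>k<n. m k) \<noteq> 0" using mult(1) unfolding m_def by (metis norm_zero zero_neq_one)
  have a0: "a k \<noteq> 0" for k by (rule cycle_nonzero[OF d n a]) (use nz in \<open>simp only: m_def not_False_eq_True\<close>)
  define R where "R = (\<lambda>x. rec_nat x (\<lambda>k r. r / m k - 1 * of_nat (d - 1) / (of_nat d * a k ^ d)))"
  have R_Suc: "R x (Suc k) = R x k / m k - 1 * of_nat (d - 1) / (of_nat d * a k ^ d)" for x k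
    by (simp add: R_def)
  have R_affine: "R x k = x / (\<Prod>i<k. m i) + R 0 k" for x k
    by (induction k) (simp add: R_def, simp add: R_Suc add_divide_distrib)
  (* the recursion is affine with slope different from 1, so it has a periodic solution *)
  define x where "x = R 0 n / (1 - 1 / (\<Prod>i<n. m i))"
  have "1 - 1 / (\<Prod>i<n. m i) \<noteq> 0" using mult(2) nz by (simp add: m_def)
  then have "x * (1 - 1 / (\<Prod>i<n. m i)) = R 0 n" by (simp add: x_def)
  then have "R x n = x" unfolding R_affine[of x n] by (simp add: algebra_simps)
  then have "R x n = R x 0" by (simp add: R_def)
  have sum0: "(\<Sum>k<n. R x k) = 0"
    using cyclic_velocity_sum[OF d a0 R_Suc[unfolded m_def] \<open>R x n = R x 0\<close> v] S by simp
  have "(\<Prod>k<n. cmod (of_nat d * a k ^ (d - 1))) = 1" unfolding prod_norm by (rule mult(1))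
  then have "(1::complex) = 0"
    by (rule invariant_polar_part_trivial(1)[OF d n a0 a inj _ R_Suc[unfolded m_def] \<open>R x n = R x 0\<close> sum0])
  then show False by simp
qed

section \<open>Regular zeros of holomorphic functions of two variables\<close>

text \<open>Partial derivatives are recorded together with their continuity, which is what the inverse function
  theorem asks for.\<close>

definition has_partials ::
  "(complex \<times> complex \<Rightarrow> complex) \<Rightarrow> (complex \<times> complex \<Rightarrow> complex) \<Rightarrow> (complex \<times> complex \<Rightarrow> complex) \<Rightarrow> bool" where
  "has_partials h hc hz \<longleftrightarrow> continuous_on UNIV hc \<and> continuous_on UNIV hz \<and>
     (\<forall>p. (h has_derivative (\<lambda>v. hc p * fst v + hz p * snd v)) (at p))"

lemma has_partials_derivative:
  "has_partials h hc hz \<Longrightarrow> (h has_derivative (\<lambda>v. hc p * fst v + hz p * snd v)) (at p)"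
  unfolding has_partials_def by blast

lemma has_partials_continuous:
  assumes "has_partials h hc hz"
  shows "continuous_on UNIV h" "continuous_on UNIV hc" "continuous_on UNIV hz"
proof -
  show "continuous_on UNIV h"
    using has_partials_derivative[OF assms] by (intro has_derivative_continuous_on) (auto intro: has_derivative_at_withinI)
qed (use assms in \<open>auto simp: has_partials_def\<close>)

lemma has_partials_const: "has_partials (\<lambda>p. k) (\<lambda>p. 0) (\<lambda>p. 0)"
  by (simp add: has_partials_def)

lemma has_partials_fst: "has_partials fst (\<lambda>p. 1) (\<lambda>p. 0)"
  by (auto simp: has_partials_def intro!: derivative_eq_intros)

lemma has_partials_snd: "has_partials snd (\<lambda>p. 0) (\<lambda>p. 1)"
  by (auto simp: has_partials_def intro!: derivative_eq_intros)

lemma has_partials_add: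
  assumes "has_partials g gc gz" "has_partials h hc hz"
  shows "has_partials (\<lambda>p. g p + h p) (\<lambda>p. gc p + hc p) (\<lambda>p. gz p + hz p)"
  using assms unfolding has_partials_def
  by (auto intro!: continuous_intros derivative_eq_intros simp: algebra_simps simp del: split_paired_All)

lemma has_partials_diff:
  assumes "has_partials g gc gz" "has_partials h hc hz"
  shows "has_partials (\<lambda>p. g p - h p) (\<lambda>p. gc p - hc p) (\<lambda>p. gz p - hz p)"
  using assms unfolding has_partials_def
  by (auto intro!: continuous_intros derivative_eq_intros simp: algebra_simps simp del: split_paired_All)

lemma has_partials_mult:
  assumes "has_partials g gc gz" "has_partials h hc hz"
  shows "has_partials (\<lambda>p. g p * h p) (\<lambda>p. g p * hc p + gc p * h p) (\<lambda>p. g p * hz p + gz p * h p)"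
  using assms has_partials_continuous[OF assms(1)] has_partials_continuous[OF assms(2)]
  unfolding has_partials_def
  by (auto intro!: continuous_intros derivative_eq_intros simp: algebra_simps simp del: split_paired_All)

lemma has_partials_along_curve:
  assumes "has_partials h hc hz"
    and "(x has_field_derivative x') (at t)" "(y has_field_derivative y') (at t)"
  shows "((\<lambda>t. h (x t, y t)) has_field_derivative hc (x t, y t) * x' + hz (x t, y t) * y') (at t)"
proof -
  have "((\<lambda>t. (x t, y t)) has_derivative (\<lambda>s. (x' * s, y' * s))) (at t)"
    using assms(2,3) unfolding has_field_derivative_def by (intro has_derivative_Pair) auto
  from has_derivative_compose[OF this has_partials_derivative[OF assms(1)]]
  show ?thesis unfolding has_field_derivative_def
    by (auto simp: algebra_simps elim!: has_derivative_eq_rhs)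
qed

lemma eventually_nhds_nonzero:
  fixes f :: "'a::topological_space \<Rightarrow> 'b::{t1_space,zero}"
  assumes "continuous_on UNIV f" "f p \<noteq> 0"
  shows "\<forall>\<^sub>F q in nhds p. f q \<noteq> 0"
proof -
  have "open (f -` (- {0}))" using assms(1) by (intro open_vimage) (auto simp: open_Compl)
  then show ?thesis using assms(2) by (auto simp: eventually_nhds intro!: exI[of _ "f -` (- {0})"])
qed

lemma complex_linear2_inv:
  fixes L :: "complex \<times> complex \<Rightarrow> complex \<times> complex"
  assumes "bij L" "\<And>a v. L (a * fst v, a * snd v) = (a * fst (L v), a * snd (L v))"
  shows "inv L (a * u, a * v) = (a * fst (inv L (u, v)), a * snd (inv L (u, v)))"
proof -
  have "L (a * fst (inv L (u, v)), a * snd (inv L (u, v))) = (a * u, a * v)"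
    using assms(2)[of a "inv L (u, v)"] assms(1) by (simp add: bij_is_surj surj_f_inv_f)
  then show ?thesis using assms(1) by (metis bij_inv_eq_iff)
qed

text \<open>The real inverse function theorem applies, and the derivative of the inverse is the inverse of a
  complex linear map, hence complex linear.\<close>

lemma holomorphic_chart:
  assumes g: "has_partials g gc gz" and h: "has_partials h hc hz"
    and det: "gc p * hz p - gz p * hc p \<noteq> 0" and N: "open N" "p \<in> N"
  obtains U V where "U \<subseteq> N" "p \<in> U" "biholomorphic2 (\<lambda>q. (g q, h q)) U V"
proof -
  let ?F = "\<lambda>q. (g q, h q)"
  let ?L = "\<lambda>q v. (gc q * fst v + gz q * snd v, hc q * fst v + hz q * snd v)"
  define F' where "F' q = Blinfun (?L q)" for q
  have bl: "bounded_linear (?L q)" for q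
    by (intro bounded_linear_Pair bounded_linear_add bounded_linear_const_mult
        bounded_linear_fst bounded_linear_snd)
  have F'_apply: "blinfun_apply (F' q) = ?L q" for q
    unfolding F'_def using bl by (rule bounded_linear_Blinfun_apply)
  have derF: "(?F has_derivative blinfun_apply (F' q)) (at q)" for q
    unfolding F'_apply by (intro has_derivative_Pair has_partials_derivative g h)
  have contF': "continuous_on N F'"
  proof (rule continuous_on_blinfun_componentwise)
    fix i :: "complex \<times> complex"
    show "continuous_on N (\<lambda>x. blinfun_apply (F' x) i)"
      unfolding F'_apply using has_partials_continuous[OF g] has_partials_continuous[OF h]
      by (auto intro!: continuous_intros intro: continuous_on_subset)
  qed
  define D where "D = gc p * hz p - gz p * hc p"
  define J where "J = Blinfun (\<lambda>v. ((hz p * fst v - gz p * snd v) / D, (gc p * snd v - hc p * fst v) / D))"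
  have J_apply: "blinfun_apply J = (\<lambda>v. ((hz p * fst v - gz p * snd v) / D, (gc p * snd v - hc p * fst v) / D))"
    unfolding J_def divide_inverse
    by (intro bounded_linear_Blinfun_apply bounded_linear_Pair bounded_linear_mult_const bounded_linear_sub
       bounded_linear_const_mult bounded_linear_fst bounded_linear_snd)
  have D0: "D \<noteq> 0" using det by (simp add: D_def)
  have "J o\<^sub>L F' p = id_blinfun"
  proof (rule blinfun_eqI)
    fix v
    have "(hz p * (gc p * fst v + gz p * snd v) - gz p * (hc p * fst v + hz p * snd v)) = D * fst v"
      "(gc p * (hc p * fst v + hz p * snd v) - hc p * (gc p * fst v + gz p * snd v)) = D * snd v"
      by (simp_all add: D_def algebra_simps)
    then show "blinfun_apply (J o\<^sub>L F' p) v = blinfun_apply id_blinfun v"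
      using D0 by (simp add: F'_apply J_apply)
  qed
  then obtain U V G G' where U: "open U" "U \<subseteq> N" "p \<in> U" and V: "open V" and "?F p \<in> V"
    and hom: "homeomorphism U V ?F G"
    and derG: "\<And>y. y \<in> V \<Longrightarrow> (G has_derivative G' y) (at y)"
    and G': "\<And>y. y \<in> V \<Longrightarrow> G' y = inv (blinfun_apply (F' (G y)))"
    and bij: "\<And>y. y \<in> V \<Longrightarrow> bij (blinfun_apply (F' (G y)))"
    by (rule inverse_function_theorem[OF N(1) derF contF' N(2)]) (rule that)
  have GF: "\<And>q. q \<in> U \<Longrightarrow> G (?F q) = q" and FG: "\<And>y. y \<in> V \<Longrightarrow> ?F (G y) = y"
    and FU: "?F ` U = V" and GV: "G ` V = U"
    using hom by (auto simp: homeomorphism_def)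
  have inj: "inj_on ?F U" by (rule inj_on_inverseI[of _ G]) (rule GF)
  have linL: "?L q (a * fst v, a * snd v) = (a * fst (?L q v), a * snd (?L q v))" for a q v
    by (simp add: algebra_simps)
  have "biholomorphic2 ?F U V"
    unfolding biholomorphic2_def
  proof (intro conjI U V)
    show "bij_betw ?F U V" using inj FU by (simp add: bij_betw_def)
    show "holomorphic2_on ?F U" unfolding holomorphic2_on_def
    proof
      fix q
      show "\<exists>f'. (?F has_derivative f') (at q) \<and>
          (\<forall>a u v. f' (a * u, a * v) = (a * fst (f' (u, v)), a * snd (f' (u, v))))"
      proof (intro exI conjI allI)
        show "(?F has_derivative ?L q) (at q)" using derF[of q] unfolding F'_apply .
        show "?L q (a * u, a * v) = (a * fst (?L q (u, v)), a * snd (?L q (u, v)))" for a u v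
          using linL[of q a "(u, v)"] by (simp only: fst_conv snd_conv)
      qed
    qed
    show "holomorphic2_on (inv_into U ?F) V" unfolding holomorphic2_on_def
    proof
      fix y assume y: "y \<in> V"
      have "inv_into U ?F w = G w" if "w \<in> V" for w
      proof (rule inv_into_f_eq[OF inj])
        show "G w \<in> U" using GV that by blast
      qed (rule FG[OF that])
      then have "(inv_into U ?F has_derivative G' y) (at y)"
        by (intro has_derivative_transform_within_open[OF derG[OF y] V y]) simp
      moreover have "G' y (a * u, a * v) = (a * fst (G' y (u, v)), a * snd (G' y (u, v)))" for a u v
        unfolding G'[OF y] by (rule complex_linear2_inv[OF bij[OF y]]) (simp only: F'_apply linL)
      ultimately show "\<exists>f'. (inv_into U ?F has_derivative f') (at y) \<and>
          (\<forall>a u v. f' (a * u, a * v) = (a * fst (f' (u, v)), a * snd (f' (u, v))))" by blast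
    qed
  qed
  then show thesis using that U by blast
qed

text \<open>One of the two coordinates of the plane completes \<open>h\<close> to a chart.\<close>

lemma straightening_at_regular_zero:
  assumes h: "has_partials h hc hz" and reg: "hc p \<noteq> 0 \<or> hz p \<noteq> 0"
    and ev: "\<forall>\<^sub>F q in nhds p. q \<in> S \<longleftrightarrow> h q = 0"
  shows "\<exists>U V f. p \<in> U \<and> biholomorphic2 f U V \<and> f ` (S \<inter> U) = {(t, w) \<in> V. w = 0}"
proof -
  obtain N where N: "open N" "p \<in> N" "\<And>q. q \<in> N \<Longrightarrow> q \<in> S \<longleftrightarrow> h q = 0"
    using ev by (auto simp: eventually_nhds)
  obtain g where "\<exists>gc gz. has_partials g gc gz \<and> gc p * hz p - gz p * hc p \<noteq> 0"
  proof (cases "hz p = 0")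
    case True
    then have "has_partials snd (\<lambda>p. 0) (\<lambda>p. 1) \<and> 0 * hz p - 1 * hc p \<noteq> 0"
      using reg has_partials_snd by simp
    then show thesis by (intro that[of snd] exI)
  next
    case False
    then have "has_partials fst (\<lambda>p. 1) (\<lambda>p. 0) \<and> 1 * hz p - 0 * hc p \<noteq> 0"
      using has_partials_fst by simp
    then show thesis by (intro that[of fst] exI)
  qed
  then obtain gc gz where g: "has_partials g gc gz" "gc p * hz p - gz p * hc p \<noteq> 0" by blast
  obtain U V where U: "U \<subseteq> N" "p \<in> U" and bi: "biholomorphic2 (\<lambda>q. (g q, h q)) U V"
    using holomorphic_chart[OF g(1) h g(2) N(1,2)] by blast
  have FU: "(\<lambda>q. (g q, h q)) ` U = V"
    using bi by (auto simp: biholomorphic2_def bij_betw_def)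
  have "(\<lambda>q. (g q, h q)) ` (S \<inter> U) = {(t, w) \<in> V. w = 0}"
  proof (intro equalityI subsetI)
    fix y assume "y \<in> (\<lambda>q. (g q, h q)) ` (S \<inter> U)"
    then obtain q where q: "q \<in> S" "q \<in> U" "y = (g q, h q)" by auto
    then have "h q = 0" using N(3)[of q] U by blast
    then show "y \<in> {(t, w) \<in> V. w = 0}" using q FU by auto
  next
    fix y assume "y \<in> {(t, w) \<in> V. w = 0}"
    then have y: "y \<in> V" "snd y = 0" by auto
    then obtain q where q: "q \<in> U" "y = (g q, h q)" using FU by blast
    then have "q \<in> S" using N(3)[of q] U y by auto
    then show "y \<in> (\<lambda>q. (g q, h q)) ` (S \<inter> U)" using q by blast
  qed
  then show ?thesis using U bi by blast
qed

text \<open>In the chart \<open>(g, h)\<close> the zero set of \<open>h\<close> is a line, parametrized by \<open>g\<close>.\<close>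

lemma zero_set_parametrization:
  assumes g: "has_partials g gc gz" and h: "has_partials h hc hz"
    and det: "gc p * hz p - gz p * hc p \<noteq> 0" and hp: "h p = 0"
  obtains \<delta> x y where "\<delta> > 0" "x holomorphic_on ball (g p) \<delta>" "y holomorphic_on ball (g p) \<delta>"
    "\<And>t. t \<in> ball (g p) \<delta> \<Longrightarrow> g (x t, y t) = t \<and> h (x t, y t) = 0"
    "(x (g p), y (g p)) = p"
    "\<forall>\<^sub>F q in nhds p. h q = 0 \<longrightarrow> g q \<in> ball (g p) \<delta> \<and> q = (x (g q), y (g q))"
proof -
  let ?F = "\<lambda>q. (g q, h q)"
  obtain U V where U: "p \<in> U" and bi: "biholomorphic2 ?F U V"
    using holomorphic_chart[OF g h det open_UNIV UNIV_I] by metis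
  define G where "G = inv_into U ?F"
  have op: "open U" "open V" and bij: "bij_betw ?F U V" and hol: "holomorphic2_on G V"
    using bi by (auto simp: biholomorphic2_def G_def)
  have GF: "G (?F q) = q" if "q \<in> U" for q
    using bij that unfolding G_def by (meson bij_betw_inv_into_left)
  have FG: "?F (G v) = v" if "v \<in> V" for v
    using bij that unfolding G_def by (meson bij_betw_inv_into_right)
  have "?F p \<in> V" using bij U by (auto simp: bij_betw_def)
  then have p0: "(g p, 0) \<in> V" using hp by simp
  have "open ((\<lambda>t. (t, 0)) -` V)" using op(2) by (intro open_vimage) (auto intro!: continuous_intros)
  then obtain \<delta> where \<delta>: "\<delta> > 0" "ball (g p) \<delta> \<subseteq> (\<lambda>t. (t, 0)) -` V"
    using p0 by (meson openE vimageI)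
  define x y where "x = (\<lambda>t. fst (G (t, 0)))" and "y = (\<lambda>t. snd (G (t, 0)))"
  have fd: "x field_differentiable at t \<and> y field_differentiable at t" if t: "(t, 0) \<in> V" for t
  proof -
    obtain f' where f': "(G has_derivative f') (at (t, 0))"
      "\<And>a u v. f' (a * u, a * v) = (a * fst (f' (u, v)), a * snd (f' (u, v)))"
      using hol t unfolding holomorphic2_on_def by meson
    define A B where "A = fst (f' (1, 0))" and "B = snd (f' (1, 0))"
    have lin: "f' (s, 0) = (A * s, B * s)" for s
      using f'(2)[of s 1 0] by (simp add: A_def B_def mult.commute)
    have "((\<lambda>t. (t, 0::complex)) has_derivative (\<lambda>s. (s, 0))) (at t)"
      by (rule has_derivative_Pair[OF has_derivative_ident has_derivative_const])
    from has_derivative_compose[OF this f'(1)]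
    have D: "((\<lambda>t. G (t, 0)) has_derivative (\<lambda>s. (A * s, B * s))) (at t)" unfolding lin .
    have "(x has_field_derivative A) (at t)" "(y has_field_derivative B) (at t)"
      using has_derivative_fst[OF D] has_derivative_snd[OF D]
      unfolding x_def y_def has_field_derivative_def by simp_all
    then show ?thesis unfolding field_differentiable_def by blast
  qed
  have \<delta>V: "(t, 0) \<in> V" if "t \<in> ball (g p) \<delta>" for t using \<delta>(2) that by blast
  show thesis
  proof (rule that[of \<delta> x y])
    show "\<delta> > 0" by fact
    show "x holomorphic_on ball (g p) \<delta>" "y holomorphic_on ball (g p) \<delta>"
      unfolding holomorphic_on_def using fd[OF \<delta>V] by (blast intro: field_differentiable_at_within)+
    show "g (x t, y t) = t \<and> h (x t, y t) = 0" if "t \<in> ball (g p) \<delta>" for t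
      using FG[OF \<delta>V[OF that]] by (simp add: x_def y_def)
    show "(x (g p), y (g p)) = p" using GF[OF U] hp by (simp add: x_def y_def)
    have "open (g -` ball (g p) \<delta>)"
      using has_partials_continuous(1)[OF g] by (intro open_vimage) auto
    then have "\<forall>\<^sub>F q in nhds p. q \<in> U \<inter> g -` ball (g p) \<delta>"
      using op U \<delta> by (intro eventually_nhds_in_open) auto
    then show "\<forall>\<^sub>F q in nhds p. h q = 0 \<longrightarrow> g q \<in> ball (g p) \<delta> \<and> q = (x (g q), y (g q))"
    proof eventually_elim
      case (elim q)
      then show ?case using GF[of q] by (auto simp: x_def y_def)
    qed
  qed
qed

text \<open>Near \<open>p\<close> the zero set of \<open>h\<close> is the graph of a holomorphic function \<open>c = x(z)\<close>, and
  \<open>hz = - hc * x'\<close> along it. Were the zeros of \<open>x'\<close> not isolated, \<open>x\<close> would be constant and \<open>h\<close>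
  would have infinitely many zeros on a vertical line.\<close>

lemma vertical_tangents_isolated:
  assumes h: "has_partials h hc hz" and hp: "h p = 0" "hc p \<noteq> 0"
    and fin: "finite {z. h (fst p, z) = 0}"
  shows "\<forall>\<^sub>F q in nhds p. h q = 0 \<longrightarrow> q = p \<or> hz q \<noteq> 0"
proof -
  have det: "0 * hz p - 1 * hc p \<noteq> 0" using hp by simp
  obtain \<delta> x y where \<delta>: "\<delta> > 0" and hol: "x holomorphic_on ball (snd p) \<delta>"
    and eq: "\<And>t. t \<in> ball (snd p) \<delta> \<Longrightarrow> snd (x t, y t) = t \<and> h (x t, y t) = 0"
    and xp: "(x (snd p), y (snd p)) = p"
    and ev: "\<forall>\<^sub>F q in nhds p. h q = 0 \<longrightarrow> snd q \<in> ball (snd p) \<delta> \<and> q = (x (snd q), y (snd q))"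
    by (rule zero_set_parametrization[OF has_partials_snd h det hp(1)]) (rule that)
  let ?B = "ball (snd p) \<delta>"
  have y: "y t = t" if "t \<in> ?B" for t using eq[OF that] by simp
  have "\<exists>\<beta>\<in>?B. deriv x \<beta> \<noteq> 0"
  proof (rule ccontr)
    assume "\<not> ?thesis"
    then have "deriv x t = 0" if "t \<in> ?B" for t using that by blast
    then have "(x has_field_derivative 0) (at t)" if "t \<in> ?B" for t
      using holomorphic_derivI[OF hol open_ball that] that by simp
    then have "x constant_on ?B"
      by (rule has_field_derivative_0_imp_constant_on) auto
    then have "x t = fst p" if "t \<in> ?B" for t
      using that xp \<delta> unfolding constant_on_def by (metis centre_in_ball fst_conv)
    then have "?B \<subseteq> {z. h (fst p, z) = 0}" using eq y by fastforce
    then have "finite ?B" using fin finite_subset by blast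
    then show False using \<delta> uncountable_ball countable_finite by blast
  qed
  then obtain \<beta> where "\<beta> \<in> ?B" "deriv x \<beta> \<noteq> 0" by blast
  then have "\<forall>\<^sub>F t in at (snd p). deriv x t \<noteq> 0 \<and> t \<in> ?B"
    using \<delta> hol by (intro non_zero_neighbour_alt[of _ ?B]) (auto intro: holomorphic_deriv)
  then have "\<forall>\<^sub>F t in nhds (snd p). t \<noteq> snd p \<longrightarrow> deriv x t \<noteq> 0"
    by (simp add: eventually_at_filter eventually_mono)
  moreover have "filterlim snd (nhds (snd p)) (nhds p)"
    by (intro tendsto_snd filterlim_ident)
  ultimately have ev2: "\<forall>\<^sub>F q in nhds p. snd q \<noteq> snd p \<longrightarrow> deriv x (snd q) \<noteq> 0"
    by (rule eventually_compose_filterlim)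
  have ev3: "\<forall>\<^sub>F q in nhds p. hc q \<noteq> 0"
    using has_partials_continuous(2)[OF h] hp(2) by (rule eventually_nhds_nonzero)
  show ?thesis
    using ev ev2 ev3
  proof eventually_elim
    case (elim q)
    show ?case
    proof (intro impI disjCI)
      assume hq: "h q = 0" and "\<not> hz q \<noteq> 0"
      define t where "t = snd q"
      have t: "t \<in> ?B" "q = (x t, y t)" using elim hq by (auto simp: t_def)
      have "(x has_field_derivative deriv x t) (at t)"
        using holomorphic_derivI[OF hol _ t(1)] by simp
      from has_partials_along_curve[OF h this DERIV_ident]
      have "((\<lambda>t. h (x t, t)) has_field_derivative hc q * deriv x t + hz q * 1) (at t)"
        using t y[OF t(1)] by simp
      moreover have "((\<lambda>t. h (x t, t)) has_field_derivative 0) (at t)"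
        by (rule has_field_derivative_transform_within_open[of "\<lambda>_. 0" _ _ ?B]) (use t eq y in auto)
      ultimately have "hc q * deriv x t + hz q = 0" using DERIV_unique by fastforce
      then have "deriv x t = 0" using elim(3) \<open>\<not> hz q \<noteq> 0\<close> by simp
      then have "t = snd p" using elim(2) by (auto simp: t_def)
      then show "q = p" using t xp by simp
    qed
  qed
qed

section \<open>Iterates and their partial derivatives\<close>

definition iter :: "nat \<Rightarrow> nat \<Rightarrow> complex \<times> complex \<Rightarrow> complex" where
  "iter d k p = (unicritical d (fst p) ^^ k) (snd p)"

lemma iter_0 [simp]: "iter d 0 p = snd p" by (simp add: iter_def)

lemma iter_Suc: "iter d (Suc k) p = iter d k p ^ d + fst p"
  by (simp add: iter_def unicritical_def)

lemma iter_add: "iter d (j + k) p = iter d j (fst p, iter d k p)"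
  by (simp add: iter_def funpow_add)

text \<open>The partial derivative of \<open>iter d k\<close> with respect to the second variable, by the chain rule; at a
  point of period \<open>k\<close> it is the multiplier of the cycle. The function \<open>iter_c\<close> is the partial
  derivative with respect to the parameter.\<close>

definition iter_z :: "nat \<Rightarrow> nat \<Rightarrow> complex \<times> complex \<Rightarrow> complex" where
  "iter_z d k p = (\<Prod>i<k. of_nat d * iter d i p ^ (d - 1))"

primrec iter_c :: "nat \<Rightarrow> nat \<Rightarrow> complex \<times> complex \<Rightarrow> complex" where
  "iter_c d 0 p = 0"
| "iter_c d (Suc k) p = of_nat d * iter d k p ^ (d - 1) * iter_c d k p + 1"

lemma has_partials_power:
  assumes "has_partials h hc hz"
  shows "has_partials (\<lambda>p. h p ^ k) (\<lambda>p. of_nat k * h p ^ (k - 1) * hc p) (\<lambda>p. of_nat k * h p ^ (k - 1) * hz p)"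
proof (induction k)
  case 0
  show ?case using has_partials_const[of 1] by simp
next
  case (Suc k)
  have *: "h p * (of_nat k * h p ^ (k - 1) * x) + x * h p ^ k = of_nat (Suc k) * h p ^ (Suc k - 1) * x" for p x
    by (cases k) (simp_all add: algebra_simps)
  show ?case using has_partials_mult[OF assms Suc] unfolding * by simp
qed

lemma has_partials_iter: "has_partials (iter d k) (iter_c d k) (iter_z d k)"
proof (induction k)
  case 0
  have "iter d 0 = snd" "iter_c d 0 = (\<lambda>p. 0)" "iter_z d 0 = (\<lambda>p. 1)"
    by (auto simp: iter_z_def)
  then show ?case using has_partials_snd by simp
next
  case (Suc k)
  have "iter d (Suc k) = (\<lambda>p. iter d k p ^ d + fst p)"
    "iter_c d (Suc k) = (\<lambda>p. of_nat d * iter d k p ^ (d - 1) * iter_c d k p + 1)"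
    "iter_z d (Suc k) = (\<lambda>p. of_nat d * iter d k p ^ (d - 1) * iter_z d k p + 0)"
    by (auto simp: iter_Suc iter_z_def mult_ac)
  then show ?case using has_partials_add[OF has_partials_power[OF Suc] has_partials_fst] by simp
qed

lemma deriv_unicritical_iterate: "deriv (unicritical d c ^^ n) z = iter_z d n (c, z)"
proof -
  have "((\<lambda>t. iter d n (c, t)) has_field_derivative iter_c d n (c, z) * 0 + iter_z d n (c, z) * 1) (at z)"
    by (rule has_partials_along_curve[OF has_partials_iter DERIV_const DERIV_ident])
  moreover have "(\<lambda>t. iter d n (c, t)) = unicritical d c ^^ n" by (simp add: iter_def)
  ultimately show ?thesis by (simp add: DERIV_imp_deriv)
qed

lemma dynatomic_set_iter:
  "dynatomic_set d n = {p. iter d n p = snd p \<and> iter_z d n p \<noteq> 1 \<and> (\<forall>m. 0 < m \<and> m < n \<longrightarrow> iter d m p \<noteq> snd p)}"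
  by (auto simp: dynatomic_set_def deriv_unicritical_iterate) (auto simp: iter_def)

text \<open>The iterate is a polynomial in \<open>z\<close> of degree \<open>d ^ n\<close>, so it is different from \<open>z\<close>.\<close>

lemma finite_iterate_fixed_points:
  assumes d: "d \<ge> 2" and n: "n \<ge> 1"
  shows "finite {z. iter d n (c, z) = z}"
proof -
  have "\<exists>P. degree P = d ^ k \<and> (\<forall>z. poly P z = iter d k (c, z))" for k
  proof (induction k)
    case 0
    show ?case by (intro exI[of _ "[:0, 1:]"]) auto
  next
    case (Suc k)
    then obtain P where P: "degree P = d ^ k" "\<And>z. poly P z = iter d k (c, z)" by blast
    have "degree (P ^ d) = d ^ Suc k"
      using P(1) d by (subst degree_power_eq) auto
    moreover have "degree [:c:] < d ^ Suc k" using d by simp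
    ultimately have "degree (P ^ d + [:c:]) = d ^ Suc k" by (simp add: degree_add_eq_left)
    then show ?case using P(2) by (intro exI[of _ "P ^ d + [:c:]"]) (simp add: iter_Suc poly_power)
  qed
  then obtain P where P: "degree P = d ^ n" "\<And>z. poly P z = iter d n (c, z)" by blast
  have "d ^ 1 \<le> d ^ n" using d n by (intro power_increasing) auto
  then have "degree P \<noteq> degree [:0, 1::complex:]" using P d n by simp
  then have "P - [:0, 1:] \<noteq> 0" by auto
  then have "finite {z. poly (P - [:0, 1:]) z = 0}" by (rule poly_roots_finite)
  then show ?thesis using P(2) by simp
qed

lemma least_period:
  fixes f :: "'a \<Rightarrow> 'a"
  assumes "n > 0" "(f ^^ n) x = x"
  obtains m where "m > 0" "\<And>k. (f ^^ k) x = x \<longleftrightarrow> m dvd k" "inj_on (\<lambda>k. (f ^^ k) x) {..<m}"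
proof -
  define m where "m = (LEAST m. 0 < m \<and> (f ^^ m) x = x)"
  have m: "0 < m \<and> (f ^^ m) x = x" unfolding m_def by (rule LeastI[of _ n]) (use assms in simp)
  have least: "m \<le> k" if "0 < k" "(f ^^ k) x = x" for k
    unfolding m_def using that by (intro Least_le) simp
  have per: "(f ^^ k) x = x \<longleftrightarrow> m dvd k" for k
  proof -
    have "(f ^^ (k mod m)) x = (f ^^ k) x" using m by (intro funpow_mod_eq) blast
    moreover have "(f ^^ (k mod m)) x = x \<longleftrightarrow> k mod m = 0"
    proof
      assume fixed: "(f ^^ (k mod m)) x = x"
      show "k mod m = 0"
      proof (rule ccontr)
        assume "k mod m \<noteq> 0"
        then have "m \<le> k mod m" using least fixed by blast
        then show False using m by (metis mod_less_divisor not_le)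
      qed
    qed simp
    ultimately show ?thesis by (simp add: dvd_eq_mod_eq_0)
  qed
  have neq: "(f ^^ i) x \<noteq> (f ^^ j) x" if "i < j" "j < m" for i j
  proof
    assume "(f ^^ i) x = (f ^^ j) x"
    then have "(f ^^ (m - j + i)) x = (f ^^ (m - j + j)) x" by (simp only: funpow_add o_apply)
    also have "\<dots> = x" using m that by simp
    finally have "m dvd m - j + i" by (simp only: per)
    then show False using that by (auto dest!: dvd_imp_le)
  qed
  have "inj_on (\<lambda>k. (f ^^ k) x) {..<m}"
    by (rule linorder_inj_onI) (use neq in auto)
  then show thesis using that m per by blast
qed

section \<open>Dividing out the fixed points of an iterate\<close>

text \<open>The quotient of \<open>a ^ d - b ^ d\<close> by \<open>a - b\<close>, written as a polynomial so that it makes sense for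
  \<open>a = b\<close>.\<close>

definition power_quotient :: "nat \<Rightarrow> complex \<Rightarrow> complex \<Rightarrow> complex" where
  "power_quotient d a b = (\<Sum>i<d. b ^ (d - Suc i) * a ^ i)"

text \<open>The quotient of \<open>f\<^sup>q\<^sup>m(z) - z\<close> by \<open>f\<^sup>m(z) - z\<close> as a polynomial: \<open>f\<^sup>q\<^sup>m(z) - z\<close> is the sum of the
  differences \<open>f\<^sup>j\<^sup>m\<^sup>+\<^sup>m(z) - f\<^sup>j\<^sup>m(z)\<close>, and each application of \<open>f\<close> multiplies a difference by a
  \<open>power_quotient\<close>.\<close>

definition iter_quotient :: "nat \<Rightarrow> nat \<Rightarrow> nat \<Rightarrow> complex \<times> complex \<Rightarrow> complex" where
  "iter_quotient d m q p = (\<Sum>j<q. \<Prod>i<j * m. power_quotient d (iter d (i + m) p) (iter d i p))"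

lemma iter_quotient_factor:
  "iter d (q * m) p - snd p = (iter d m p - snd p) * iter_quotient d m q p"
proof -
  have step: "iter d (N + m) p - iter d N p =
     (iter d m p - snd p) * (\<Prod>i<N. power_quotient d (iter d (i + m) p) (iter d i p))" for N
  proof (induction N)
    case (Suc N)
    have "iter d (Suc N + m) p - iter d (Suc N) p = iter d (N + m) p ^ d - iter d N p ^ d"
      by (simp add: iter_Suc)
    also have "\<dots> = (iter d (N + m) p - iter d N p) * power_quotient d (iter d (N + m) p) (iter d N p)"
      unfolding power_quotient_def by (rule power_diff_sumr2)
    finally show ?case by (simp add: Suc mult_ac)
  qed simp
  have "iter d (q * m) p - snd p = (\<Sum>j<q. iter d (Suc j * m) p - iter d (j * m) p)"
    by (subst sum_lessThan_telescope[of "\<lambda>j. iter d (j * m) p"]) simp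
  also have "\<dots> = (\<Sum>j<q. iter d (j * m + m) p - iter d (j * m) p)"
    by (simp add: add.commute)
  finally show ?thesis by (simp only: step iter_quotient_def sum_distrib_left)
qed

lemma iter_z_mult_fixed:
  assumes "iter d m p = snd p"
  shows "iter_z d (j * m) p = iter_z d m p ^ j"
proof -
  have per: "iter d (j * m) p = snd p" for j
    using assms by (induction j) (simp_all add: iter_add)
  have split: "(\<Prod>i<a + b. f i) = (\<Prod>i<a. f i) * (\<Prod>i<b. f (a + i))" for a b :: nat and f :: "nat \<Rightarrow> complex"
    by (induction b) (simp_all add: mult_ac)
  show ?thesis
  proof (induction j)
    case (Suc j)
    have "iter d (j * m + i) p = iter d i p" for i
      using per[of j] by (subst add.commute) (simp add: iter_add)
    then have "iter_z d (j * m + m) p = iter_z d (j * m) p * iter_z d m p"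
      unfolding iter_z_def split by simp
    then show ?case using Suc by (simp add: add.commute mult.commute)
  qed (simp add: iter_z_def)
qed

text \<open>At a fixed point each factor \<open>power_quotient\<close> degenerates to the derivative of \<open>f\<close>, and the product
  of these factors runs through the cycle \<open>j\<close> times.\<close>

lemma iter_quotient_fixed:
  assumes d: "d \<ge> 1" and fixed: "iter d m p = snd p"
  shows "iter_quotient d m q p = (\<Sum>j<q. iter_z d m p ^ j)"
proof -
  have "power_quotient d a a = of_nat d * a ^ (d - 1)" for a
  proof -
    have "power_quotient d a a = (\<Sum>i<d. a ^ (d - 1))"
      unfolding power_quotient_def by (intro sum.cong refl) (simp add: power_add[symmetric])
    then show ?thesis by simp
  qed
  moreover have "iter d (i + m) p = iter d i p" for i using fixed by (simp add: iter_add)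
  ultimately have "iter_quotient d m q p = (\<Sum>j<q. iter_z d (j * m) p)"
    by (simp add: iter_quotient_def iter_z_def)
  then show ?thesis by (simp add: iter_z_mult_fixed[OF fixed])
qed

lemma iter_quotient_has_partials: "\<exists>hc hz. has_partials (iter_quotient d m q) hc hz"
proof -
  define C1 where "C1 h = (\<exists>hc hz. has_partials h hc hz)" for h
  have const: "C1 (\<lambda>p. k)" for k unfolding C1_def using has_partials_const by blast
  have add: "C1 (\<lambda>p. g p + h p)" if "C1 g" "C1 h" for g h
    using that has_partials_add unfolding C1_def by blast
  have mult: "C1 (\<lambda>p. g p * h p)" if "C1 g" "C1 h" for g h
    using that has_partials_mult unfolding C1_def by blast
  have power: "C1 (\<lambda>p. g p ^ k)" if "C1 g" for g k
    using that has_partials_power unfolding C1_def by blast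
  have sum: "C1 (\<lambda>p. \<Sum>i<k. f i p)" if "\<And>i. C1 (f i)" for k :: nat and f
    by (induction k) (simp_all add: const add that)
  have prod: "C1 (\<lambda>p. \<Prod>i<k. f i p)" if "\<And>i. C1 (f i)" for k :: nat and f
    by (induction k) (simp_all add: const mult that)
  have iter: "C1 (iter d k)" for k unfolding C1_def using has_partials_iter by blast
  have "C1 (iter_quotient d m q)"
    unfolding iter_quotient_def[abs_def] power_quotient_def
    by (intro sum prod mult power iter)
  then show ?thesis by (simp add: C1_def)
qed

section \<open>Smoothness\<close>

text \<open>The \<open>c\<close>-derivatives of the iterates solve the velocity recursion with initial value 0; their
  vanishing after \<open>n\<close> steps would make this solution cyclic.\<close>

lemma parameter_derivative_nonzero_at_parabolic:
  assumes d: "d \<ge> 2" and n: "n \<ge> 1" and per: "iter d n p = snd p"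
    and inj: "inj_on (\<lambda>k. iter d k p) {..<n}" and mult: "iter_z d n p = 1"
  shows "iter_c d n p \<noteq> 0"
proof -
  have "iter_c d n p \<noteq> iter_c d 0 p"
    using parabolic_cycle_no_cyclic_velocity[of d n "\<lambda>k. iter d k p" "fst p" "\<lambda>k. iter_c d k p"]
      d n per inj mult by (simp add: iter_Suc iter_z_def)
  then show ?thesis by simp
qed

lemma logarithmic_derivative_prod:
  fixes f :: "nat \<Rightarrow> complex \<Rightarrow> complex"
  assumes "\<And>k. (f k has_field_derivative f' k) (at t)" "\<And>k. f k t \<noteq> 0"
  shows "((\<lambda>s. \<Prod>k<n. f k s) has_field_derivative (\<Prod>k<n. f k t) * (\<Sum>k<n. f' k / f k t)) (at t)"
proof (induction n)
  case (Suc n)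
  have "((\<lambda>s. (\<Prod>k<n. f k s) * f n s) has_field_derivative
      (\<Prod>k<n. f k t) * (\<Sum>k<n. f' k / f k t) * f n t + f' n * (\<Prod>k<n. f k t)) (at t)"
    by (rule DERIV_mult[OF Suc assms(1)])
  moreover have "(\<Prod>k<n. f k t) * (\<Sum>k<n. f' k / f k t) * f n t + f' n * (\<Prod>k<n. f k t)
     = (\<Prod>k<Suc n. f k t) * (\<Sum>k<Suc n. f' k / f k t)"
    using assms(2)[of n] by (simp add: distrib_left mult_ac)
  ultimately show ?case by simp
qed simp

text \<open>Differentiate \<open>(\<Sum>j<q. x ^ j) * (x - 1) = x ^ q - 1\<close> at \<open>\<mu>\<close>, where the geometric sum vanishes.\<close>

lemma geometric_sum_derivative_nonzero:
  fixes \<mu> :: complex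
  assumes "\<mu> ^ q = 1" "\<mu> \<noteq> 1" "q \<ge> 1"
  shows "(\<Sum>j<q. of_nat j * \<mu> ^ (j - 1)) \<noteq> 0"
proof
  assume z: "(\<Sum>j<q. of_nat j * \<mu> ^ (j - 1)) = 0"
  have "((\<lambda>x. (\<Sum>j<q. x ^ j) * (x - 1)) has_field_derivative
     (\<Sum>j<q. of_nat j * \<mu> ^ (j - 1)) * (\<mu> - 1) + (\<Sum>j<q. \<mu> ^ j)) (at \<mu>)"
    by (auto intro!: derivative_eq_intros)
  moreover have "(\<Sum>j<q. \<mu> ^ j) = 0" using assms by (simp add: geometric_sum)
  moreover have "(\<lambda>x::complex. (\<Sum>j<q. x ^ j) * (x - 1)) = (\<lambda>x. x ^ q - 1)"
    by (simp add: fun_eq_iff power_diff_1_eq mult.commute)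
  ultimately have "((\<lambda>x::complex. x ^ q - 1) has_field_derivative 0) (at \<mu>)" using z by simp
  moreover have "((\<lambda>x::complex. x ^ q - 1) has_field_derivative of_nat q * \<mu> ^ (q - 1)) (at \<mu>)"
    by (auto intro!: derivative_eq_intros)
  ultimately have "of_nat q * \<mu> ^ (q - 1) = 0" using DERIV_unique by blast
  then show False using assms by (auto simp: power_0_left split: if_splits)
qed

text \<open>The determinant is that of the gradients of \<open>f\<^sup>m(z) - z\<close> and of \<open>iter_quotient\<close>. As the multiplier
  is not 1, the periodic point can be followed as a holomorphic function \<open>y\<close> of \<open>c\<close>. Along this curve
  \<open>iter_quotient\<close> is the geometric sum of the multiplier, so its derivative is that of the multiplier
  times a nonzero number. Both derivatives are nonzero, so \<open>iter_quotient\<close> is not stationary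
  along the curve where \<open>f\<^sup>m(z) = z\<close>.\<close>

lemma quotient_transversal_to_fixed_points:
  assumes d: "d \<ge> 2" and m: "m \<ge> 1" and per: "iter d m p = snd p"
    and inj: "inj_on (\<lambda>k. iter d k p) {..<m}"
    and mult: "iter_z d m p ^ q = 1" "iter_z d m p \<noteq> 1" and q: "q \<ge> 1"
    and h: "has_partials (iter_quotient d m q) hc hz"
  shows "iter_c d m p * hz p - (iter_z d m p - 1) * hc p \<noteq> 0"
proof
  assume det: "iter_c d m p * hz p - (iter_z d m p - 1) * hc p = 0"
  define \<mu> where "\<mu> = iter_z d m p"
  have \<mu>0: "\<mu> \<noteq> 0" using mult(1) q by (auto simp: \<mu>_def power_0_left split: if_splits)
  have norm: "cmod \<mu> = 1"
  proof -
    have "cmod \<mu> ^ q = 1" using mult(1) by (simp add: \<mu>_def norm_power[symmetric])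
    then show ?thesis using q power_eq_imp_eq_base[of "cmod \<mu>" q 1] by simp
  qed
  have a0: "iter d k p \<noteq> 0" for k
    by (rule cycle_nonzero[of d m "\<lambda>k. iter d k p" "fst p"])
       (use d m per \<mu>0 in \<open>simp_all only: iter_Suc iter_0 \<mu>_def iter_z_def simp_thms\<close>)
  let ?g = "\<lambda>p. iter d m p - snd p"
  have g: "has_partials ?g (\<lambda>p. iter_c d m p - 0) (\<lambda>p. iter_z d m p - 1)"
    by (rule has_partials_diff[OF has_partials_iter has_partials_snd])
  have g1: "1 * (iter_z d m p - 1) - 0 * (iter_c d m p - 0) \<noteq> 0" using mult(2) by simp
  have g0: "iter d m p - snd p = 0" using per by simp
  obtain \<delta> x y where \<delta>: "\<delta> > 0" and hol: "x holomorphic_on ball (fst p) \<delta>" "y holomorphic_on ball (fst p) \<delta>"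
    and eq: "\<And>t. t \<in> ball (fst p) \<delta> \<Longrightarrow> fst (x t, y t) = t \<and> iter d m (x t, y t) - snd (x t, y t) = 0"
    and xp: "(x (fst p), y (fst p)) = p"
    by (rule zero_set_parametrization[OF has_partials_fst g g1 g0]) (rule that)
  let ?B = "ball (fst p) \<delta>"
  have fixed: "iter d m (t, y t) = y t" if "t \<in> ?B" for t
  proof -
    have "x t = t" "iter d m (x t, y t) = y t" using eq[OF that] by auto
    then show ?thesis by simp
  qed
  have "x (fst p) = fst p" using eq[of "fst p"] \<delta> by simp
  then have yp: "(fst p, y (fst p)) = p" using xp by simp
  define w where "w = deriv y (fst p)"
  have yw: "(y has_field_derivative w) (at (fst p))"
    unfolding w_def using \<delta> by (intro holomorphic_derivI[OF hol(2)]) auto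
  note curve = has_partials_along_curve[OF _ DERIV_ident yw, unfolded yp]
  define v where "v = (\<lambda>k. iter_c d k p + iter_z d k p * w)"
  have der_iter: "((\<lambda>t. iter d k (t, y t)) has_field_derivative v k) (at (fst p))" for k
    using curve[OF has_partials_iter] by (simp add: v_def)
  have v_Suc: "v (Suc k) = of_nat d * iter d k p ^ (d - 1) * v k + 1" for k
    by (simp add: v_def iter_z_def algebra_simps)
  have "((\<lambda>t. iter d m (t, y t)) has_field_derivative w) (at (fst p))"
    by (rule has_field_derivative_transform_within_open[OF yw open_ball[of "fst p" \<delta>]]) (use \<delta> fixed in auto)
  then have "v m = w" using der_iter DERIV_unique by blast
  then have vm: "v m = v 0" by (simp add: v_def iter_z_def)
  have S: "(\<Sum>k<m. v k / iter d k p) \<noteq> 0"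
    by (rule indifferent_cycle_multiplier_velocity[of d m _ "fst p"])
      (use d m per inj norm mult v_Suc vm in \<open>simp_all add: iter_Suc iter_z_def \<mu>_def\<close>)
  define \<mu>' where "\<mu>' = \<mu> * (\<Sum>k<m. of_nat (d - 1) * (v k / iter d k p))"
  have der_mult: "((\<lambda>t. iter_z d m (t, y t)) has_field_derivative \<mu>') (at (fst p))"
  proof -
    define f where "f = (\<lambda>k t. of_nat d * iter d k (t, y t) ^ (d - 1))"
    define f' where "f' = (\<lambda>k. f k (fst p) * (of_nat (d - 1) * (v k / iter d k p)))"
    have f0: "f k (fst p) \<noteq> 0" for k using a0 d yp by (simp add: f_def)
    have "(f k has_field_derivative f' k) (at (fst p))" for k
    proof -
      have "((\<lambda>t. of_nat d * iter d k (t, y t) ^ (d - 1)) has_field_derivative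
          of_nat d * (of_nat (d - 1) * (v k * iter d k p ^ (d - 1 - Suc 0)))) (at (fst p))"
        using DERIV_cmult[OF DERIV_power[OF der_iter[of k], of "d - 1"], of "of_nat d"] unfolding yp
        by (simp only: mult_ac)
      moreover have "of_nat d * (of_nat (d - 1) * (v k * iter d k p ^ (d - 1 - Suc 0))) = f' k"
      proof -
        have "iter d k p ^ (d - 1) = iter d k p ^ (d - 1 - Suc 0) * iter d k p"
          using d power_minus_mult[of "d - 1" "iter d k p"] by simp
        then show ?thesis using a0[of k] yp by (simp add: f'_def f_def)
      qed
      ultimately show ?thesis unfolding f_def by simp
    qed
    from logarithmic_derivative_prod[of f f', OF this f0, of m]
    have "((\<lambda>t. \<Prod>k<m. f k t) has_field_derivative (\<Prod>k<m. f k (fst p)) * (\<Sum>k<m. f' k / f k (fst p))) (at (fst p))" .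
    moreover have "(\<lambda>t. \<Prod>k<m. f k t) = (\<lambda>t. iter_z d m (t, y t))" by (simp add: f_def iter_z_def)
    moreover have "(\<Prod>k<m. f k (fst p)) = \<mu>" using yp by (simp add: f_def \<mu>_def iter_z_def)
    moreover have "f' k / f k (fst p) = of_nat (d - 1) * (v k / iter d k p)" for k
      using f0[of k] by (simp add: f'_def)
    ultimately show ?thesis by (simp add: \<mu>'_def)
  qed
  have "((\<lambda>t. \<Sum>j<q. iter_z d m (t, y t) ^ j) has_field_derivative
      (\<Sum>j<q. of_nat j * (\<mu>' * iter_z d m p ^ (j - Suc 0)))) (at (fst p))"
    using DERIV_sum[of "{..<q}", OF DERIV_power[OF der_mult]] unfolding yp .
  then have "((\<lambda>t. iter_quotient d m q (t, y t)) has_field_derivative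
      (\<Sum>j<q. of_nat j * (\<mu>' * iter_z d m p ^ (j - Suc 0)))) (at (fst p))"
    by (rule has_field_derivative_transform_within_open[OF _ open_ball[of "fst p" \<delta>]])
      (use \<delta> d fixed in \<open>simp_all add: iter_quotient_fixed\<close>)
  then have "hc p * 1 + hz p * w = (\<Sum>j<q. of_nat j * (\<mu>' * iter_z d m p ^ (j - Suc 0)))"
    using curve[OF h] DERIV_unique by blast
  also have "\<dots> = \<mu>' * (\<Sum>j<q. of_nat j * \<mu> ^ (j - 1))"
    by (simp add: sum_distrib_left \<mu>_def mult_ac)
  also have "\<dots> \<noteq> 0"
  proof -
    have "of_nat (d - 1) \<noteq> (0::complex)" using d by (subst of_nat_eq_0_iff) simp
    then have "\<mu>' \<noteq> 0"
      using S \<mu>0 unfolding \<mu>'_def sum_distrib_left[symmetric] by (intro no_zero_divisors)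
    then show ?thesis
      using geometric_sum_derivative_nonzero[of \<mu> q] mult q by (simp add: \<mu>_def)
  qed
  finally have "hc p + hz p * w \<noteq> 0" by simp
  moreover have "iter_c d m p + (\<mu> - 1) * w = 0"
    using vm by (simp add: v_def \<mu>_def iter_z_def algebra_simps)
  then have "iter_c d m p * hz p - (\<mu> - 1) * hc p = - ((\<mu> - 1) * (hc p + hz p * w))"
  proof -
    assume *: "iter_c d m p + (\<mu> - 1) * w = 0"
    have "iter_c d m p * hz p - (\<mu> - 1) * hc p
      = (iter_c d m p + (\<mu> - 1) * w) * hz p - ((\<mu> - 1) * (hc p + hz p * w))"
      by (simp add: algebra_simps)
    then show ?thesis using * by simp
  qed
  ultimately show False using det mult(2) by (simp add: \<mu>_def)
qed


lemma fixed_on_closure: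
  assumes "p \<in> closure (dynatomic_set d n)"
  shows "iter d n p = snd p"
proof -
  have "closed {p. iter d n p - snd p = 0}"
    using continuous_closed_preimage_constant[OF has_partials_continuous(1)[OF
        has_partials_diff[OF has_partials_iter has_partials_snd]], of d n 0] by simp
  moreover have "dynatomic_set d n \<subseteq> {p. iter d n p - snd p = 0}"
    by (auto simp: dynatomic_set_iter)
  ultimately have "p \<in> {p. iter d n p - snd p = 0}" using closure_minimal assms by blast
  then show ?thesis by simp
qed

text \<open>Here the closure is locally the zero set of \<open>f\<^sup>n(z) - z\<close>. Points near \<open>p\<close> cannot have a smaller
  period, so the only zeros that may fail to belong to the set are those with multiplier 1, and these
  are isolated. Nothing has to be shown for \<open>p\<close> itself, which lies in the closure by assumption.\<close>

lemma smooth_point_exact_period: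
  assumes d: "d \<ge> 2" and n: "n \<ge> 1" and p: "p \<in> closure (dynatomic_set d n)"
    and per: "iter d n p = snd p" "inj_on (\<lambda>k. iter d k p) {..<n}"
  obtains h hc hz where "has_partials h hc hz" "hc p \<noteq> 0 \<or> hz p \<noteq> 0"
    "\<forall>\<^sub>F q in nhds p. q \<in> closure (dynatomic_set d n) \<longleftrightarrow> h q = 0"
proof -
  let ?h = "\<lambda>q. iter d n q - snd q" and ?hz = "\<lambda>q. iter_z d n q - 1"
  have h: "has_partials ?h (\<lambda>q. iter_c d n q - 0) ?hz"
    by (rule has_partials_diff[OF has_partials_iter has_partials_snd])
  have ne: "\<forall>\<^sub>F q in nhds p. \<forall>k\<in>{0<..<n}. iter d k q - snd q \<noteq> 0"
  proof (subst eventually_ball_finite_distrib, simp, intro ballI eventually_nhds_nonzero)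
    fix k assume k: "k \<in> {0<..<n}"
    then show "iter d k p - snd p \<noteq> 0"
      using inj_onD[OF per(2), of k 0] by auto
    show "continuous_on UNIV (\<lambda>q. iter d k q - snd q)"
      by (rule has_partials_continuous(1)[OF has_partials_diff[OF has_partials_iter has_partials_snd]])
  qed
  have mult: "\<forall>\<^sub>F q in nhds p. ?h q = 0 \<longrightarrow> q = p \<or> ?hz q \<noteq> 0"
  proof (cases "iter_z d n p = 1")
    case True
    have "finite {z. ?h (fst p, z) = 0}"
      using finite_iterate_fixed_points[OF d n] by simp
    then show ?thesis
      using parameter_derivative_nonzero_at_parabolic[OF d n per True] per(1)
      by (intro vertical_tangents_isolated[OF h]) auto
  next
    case False
    then have "\<forall>\<^sub>F q in nhds p. ?hz q \<noteq> 0"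
      using has_partials_continuous(3)[OF h] by (intro eventually_nhds_nonzero) auto
    then show ?thesis by eventually_elim simp
  qed
  show thesis
  proof (rule that[OF h])
    show "iter_c d n p - 0 \<noteq> 0 \<or> ?hz p \<noteq> 0"
      using parameter_derivative_nonzero_at_parabolic[OF d n per] by auto
    show "\<forall>\<^sub>F q in nhds p. q \<in> closure (dynatomic_set d n) \<longleftrightarrow> ?h q = 0"
      using ne mult
    proof eventually_elim
      case (elim q)
      have "q \<in> closure (dynatomic_set d n)" if "?h q = 0"
      proof (cases "q = p")
        case False
        then have "q \<in> dynatomic_set d n" using elim that by (auto simp: dynatomic_set_iter)
        then show ?thesis using closure_subset by blast
      qed (use p in simp)
      then show ?case using fixed_on_closure[of q d n] by auto
    qed
  qed
qed

text \<open>On \<open>dynatomic_set d (q * m)\<close> the factor \<open>f\<^sup>m(z) - z\<close> is nonzero.\<close>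

lemma quotient_vanishes_on_closure:
  assumes m: "0 < m" "m < q * m" and p: "p \<in> closure (dynatomic_set d (q * m))"
  shows "iter_quotient d m q p = 0"
proof -
  obtain hc hz where h: "has_partials (iter_quotient d m q) hc hz"
    using iter_quotient_has_partials by blast
  have "iter_quotient d m q p = 0" if "p \<in> dynatomic_set d (q * m)" for p
    using that m iter_quotient_factor[of d q m p] by (auto simp: dynatomic_set_iter)
  then have "dynatomic_set d (q * m) \<subseteq> {p. iter_quotient d m q p = 0}" by blast
  moreover have "closed {p. iter_quotient d m q p = 0}"
    using continuous_closed_preimage_constant[OF has_partials_continuous(1)[OF h]] by simp
  ultimately show ?thesis using closure_minimal p by blast
qed

text \<open>Here cycles of period \<open>n\<close> collapse onto a cycle of period \<open>m\<close>, and the closure is locally the zero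
  set of \<open>iter_quotient\<close>. That this function, and its analogues for the other multiples of \<open>m\<close> properly
  dividing \<open>n\<close>, vanish on the closure forces the multiplier \<open>\<mu>\<close> to be a primitive \<open>q\<close>-th root of unity. Primitivity in
  turn rules out smaller periods for the nearby zeros.\<close>

lemma smooth_point_smaller_period:
  assumes d: "d \<ge> 2" and m: "m \<ge> 1" and n: "n = q * m" "q \<ge> 2"
    and p: "p \<in> closure (dynatomic_set d n)"
    and per: "\<And>k. iter d k p = snd p \<longleftrightarrow> m dvd k" and inj: "inj_on (\<lambda>k. iter d k p) {..<m}"
  obtains h hc hz where "has_partials h hc hz" "hc p \<noteq> 0 \<or> hz p \<noteq> 0"
    "\<forall>\<^sub>F q in nhds p. q \<in> closure (dynatomic_set d n) \<longleftrightarrow> h q = 0"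
proof -
  define \<mu> where "\<mu> = iter_z d m p"
  have d1: "d \<ge> 1" using d by simp
  have fixed: "iter d m p = snd p" using per by simp
  have mn: "m < n" using n m by simp
  have vanish: "(\<Sum>j<l. (\<mu> ^ r) ^ j) = 0" if "q = l * r" "r \<ge> 1" "r < q" for l r
  proof -
    have "iter_quotient d (r * m) l p = 0"
      using p n m that by (intro quotient_vanishes_on_closure) (auto simp: mult.assoc)
    moreover have "iter d (r * m) p = snd p" using per by simp
    ultimately show ?thesis
      using iter_quotient_fixed[OF d1] iter_z_mult_fixed[OF fixed] by (simp add: \<mu>_def)
  qed
  have sum0: "(\<Sum>j<q. \<mu> ^ j) = 0" using vanish[of q 1] n by simp
  have \<mu>1: "\<mu> \<noteq> 1" using sum0 n by auto
  then have \<mu>q: "\<mu> ^ q = 1" using sum0 by (simp add: geometric_sum)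
  have primitive: "\<mu> ^ k \<noteq> 1" if k: "0 < k" "k < q" for k
  proof
    assume "\<mu> ^ k = 1"
    have pow: "((*) \<mu> ^^ k) 1 = \<mu> ^ k" for k by (induction k) simp_all
    obtain r where r: "r > 0" "\<And>k. ((*) \<mu> ^^ k) 1 = 1 \<longleftrightarrow> r dvd k"
      using least_period[of k "(*) \<mu>" 1] k \<open>\<mu> ^ k = 1\<close> pow by metis
    have "r dvd q" "r dvd k" "\<mu> ^ r = 1"
      using r(2)[of q] r(2)[of k] r(2)[of r] \<mu>q \<open>\<mu> ^ k = 1\<close> by (simp_all add: pow)
    then obtain l where l: "q = l * r" by (metis dvd_def mult.commute)
    have "r < q" using \<open>r dvd k\<close> k by (auto dest: dvd_imp_le)
    then have "(\<Sum>j<l. (\<mu> ^ r) ^ j) = 0" using vanish[OF l] r by simp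
    then have "of_nat l = (0::complex)" using \<open>\<mu> ^ r = 1\<close> by simp
    then show False using l n by simp
  qed
  let ?g = "\<lambda>p. iter d m p - snd p" and ?h = "iter_quotient d m q"
  obtain hc hz where h: "has_partials ?h hc hz" using iter_quotient_has_partials by blast
  have hp: "?h p = 0" using sum0 iter_quotient_fixed[OF d1 fixed] by (simp add: \<mu>_def)
  have g: "has_partials ?g (\<lambda>p. iter_c d m p - 0) (\<lambda>p. iter_z d m p - 1)"
    by (rule has_partials_diff[OF has_partials_iter has_partials_snd])
  have det: "(iter_c d m p - 0) * hz p - (iter_z d m p - 1) * hc p \<noteq> 0"
    using quotient_transversal_to_fixed_points[OF d m fixed inj _ _ _ h] \<mu>q \<mu>1 n by (simp add: \<mu>_def)
  have factor: "iter d n p' - snd p' = ?g p' * ?h p'" for p'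
    unfolding n by (rule iter_quotient_factor)
  (* ?g and ?h are local coordinates at p, so p is their only common zero nearby *)
  have only: "\<forall>\<^sub>F p' in nhds p. ?h p' = 0 \<longrightarrow> p' = p \<or> ?g p' \<noteq> 0"
  proof -
    obtain U V where U: "p \<in> U" and bi: "biholomorphic2 (\<lambda>p'. (?g p', ?h p')) U V"
      using holomorphic_chart[OF g h det open_UNIV UNIV_I] by metis
    have inj: "inj_on (\<lambda>p'. (?g p', ?h p')) U" and "open U"
      using bi by (auto simp: biholomorphic2_def bij_betw_def)
    have "\<forall>\<^sub>F p' in nhds p. p' \<in> U" using U \<open>open U\<close> by (rule eventually_nhds_in_open[rotated])
    then show ?thesis
    proof eventually_elim
      case (elim p')
      then show ?case using inj_onD[OF inj, of p' p] U hp fixed by auto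
    qed
  qed
  have periods: "\<forall>\<^sub>F p' in nhds p. \<forall>k\<in>{0<..<n}. ?g p' \<noteq> 0 \<longrightarrow> iter d k p' - snd p' \<noteq> 0"
  proof (subst eventually_ball_finite_distrib, simp, intro ballI)
    fix k assume k: "k \<in> {0<..<n}"
    show "\<forall>\<^sub>F p' in nhds p. ?g p' \<noteq> 0 \<longrightarrow> iter d k p' - snd p' \<noteq> 0"
    proof (cases "m dvd k")
      case True
      then obtain j where j: "k = j * m" by (metis dvd_def mult.commute)
      then have jq: "0 < j" "j < q" using k n by auto
      obtain jc jz where jh: "has_partials (iter_quotient d m j) jc jz"
        using iter_quotient_has_partials by blast
      have "(\<mu> - 1) * (\<Sum>i<j. \<mu> ^ i) = \<mu> ^ j - 1" by (simp add: power_diff_1_eq)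
      then have "(\<Sum>i<j. \<mu> ^ i) \<noteq> 0" using primitive[OF jq] by auto
      then have "iter_quotient d m j p \<noteq> 0"
        using iter_quotient_fixed[OF d1 fixed] by (simp add: \<mu>_def)
      then have "\<forall>\<^sub>F p' in nhds p. iter_quotient d m j p' \<noteq> 0"
        using has_partials_continuous(1)[OF jh] by (intro eventually_nhds_nonzero)
      then show ?thesis by eventually_elim (simp add: j iter_quotient_factor)
    next
      case False
      then have "iter d k p - snd p \<noteq> 0" using per by simp
      then have "\<forall>\<^sub>F p' in nhds p. iter d k p' - snd p' \<noteq> 0"
        using has_partials_continuous(1)[OF has_partials_diff[OF has_partials_iter has_partials_snd]]
        by (intro eventually_nhds_nonzero)
      then show ?thesis by eventually_elim simp
    qed
  qed
  have mult: "iter_z d n p' - 1 = ?g p' * hz p'" if "?h p' = 0" for p'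
  proof -
    have eq: "(\<lambda>p'. iter d n p' - snd p') = (\<lambda>p'. ?g p' * ?h p')" using factor by auto
    have "((\<lambda>p'. iter d n p' - snd p') has_derivative
       (\<lambda>v. (iter_c d n p' - 0) * fst v + (iter_z d n p' - 1) * snd v)) (at p')"
      by (rule has_partials_derivative[OF has_partials_diff[OF has_partials_iter has_partials_snd]])
    moreover have "((\<lambda>p'. iter d n p' - snd p') has_derivative
       (\<lambda>v. (?g p' * hc p' + (iter_c d m p' - 0) * ?h p') * fst v + (?g p' * hz p' + (iter_z d m p' - 1) * ?h p') * snd v)) (at p')"
      unfolding eq by (rule has_partials_derivative[OF has_partials_mult[OF g h]])
    ultimately have "(\<lambda>v. (iter_c d n p' - 0) * fst v + (iter_z d n p' - 1) * snd v) =
       (\<lambda>v. (?g p' * hc p' + (iter_c d m p' - 0) * ?h p') * fst v + (?g p' * hz p' + (iter_z d m p' - 1) * ?h p') * snd v)"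
      by (rule has_derivative_unique)
    from fun_cong[OF this, of "(0, 1)"] show ?thesis using that by simp
  qed
  have tangent: "\<forall>\<^sub>F p' in nhds p. ?h p' = 0 \<longrightarrow> p' = p \<or> hz p' \<noteq> 0"
  proof (cases "hz p = 0")
    case True
    have "{z. ?h (fst p, z) = 0} \<subseteq> {z. iter d n (fst p, z) = z}"
    proof
      fix z assume "z \<in> {z. ?h (fst p, z) = 0}"
      then show "z \<in> {z. iter d n (fst p, z) = z}" using factor[of "(fst p, z)"] by simp
    qed
    moreover have "finite {z. iter d n (fst p, z) = z}"
      using finite_iterate_fixed_points[OF d] mn by simp
    ultimately have "finite {z. ?h (fst p, z) = 0}" by (rule finite_subset)
    then show ?thesis
      using det True hp by (intro vertical_tangents_isolated[OF h]) auto
  next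
    case False
    then have "\<forall>\<^sub>F p' in nhds p. hz p' \<noteq> 0"
      using has_partials_continuous(3)[OF h] by (intro eventually_nhds_nonzero)
    then show ?thesis by eventually_elim simp
  qed
  show thesis
  proof (rule that[OF h])
    show "hc p \<noteq> 0 \<or> hz p \<noteq> 0" using det by auto
    show "\<forall>\<^sub>F p' in nhds p. p' \<in> closure (dynatomic_set d n) \<longleftrightarrow> ?h p' = 0"
      using only periods tangent
    proof eventually_elim
      case (elim p')
      have "p' \<in> closure (dynatomic_set d n)" if hp': "?h p' = 0"
      proof (cases "p' = p")
        case False
        then have "?g p' \<noteq> 0" "hz p' \<noteq> 0" using elim hp' by auto
        then have "iter d n p' = snd p'" "iter_z d n p' \<noteq> 1"
          using factor[of p'] mult[OF hp'] hp' by auto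
        then have "p' \<in> dynatomic_set d n"
          using elim(2) \<open>?g p' \<noteq> 0\<close> by (auto simp: dynatomic_set_iter)
        then show ?thesis using closure_subset by blast
      qed (use p in simp)
      moreover have "?h p' = 0" if "p' \<in> closure (dynatomic_set d n)"
        using quotient_vanishes_on_closure[of m q p' d] that m mn n by simp
      ultimately show ?case by blast
    qed
  qed
qed

theorem theorem1p1:
  fixes d n :: nat
  assumes "d \<ge> 2" and "n \<ge> 1"
  shows "smooth_curve (closure (dynatomic_set d n))"
proof -
  let ?S = "closure (dynatomic_set d n)"
  have "\<exists>U V f. p \<in> U \<and> biholomorphic2 f U V \<and> f ` (?S \<inter> U) = {(t, w) \<in> V. w = 0}" if p: "p \<in> ?S" for p
  proof -
    have fixed: "iter d n p = snd p" by (rule fixed_on_closure[OF p])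
    then have "(unicritical d (fst p) ^^ n) (snd p) = snd p" by (simp add: iter_def)
    then obtain m where m: "m > 0" "\<And>k. iter d k p = snd p \<longleftrightarrow> m dvd k" "inj_on (\<lambda>k. iter d k p) {..<m}"
      using least_period[of n "unicritical d (fst p)" "snd p"] assms(2) unfolding iter_def by auto
    have "m dvd n" using m(2)[of n] fixed by simp
    then obtain q where q: "n = q * m" by (metis dvd_def mult.commute)
    obtain h hc hz where "has_partials h hc hz" "hc p \<noteq> 0 \<or> hz p \<noteq> 0"
       "\<forall>\<^sub>F q in nhds p. q \<in> ?S \<longleftrightarrow> h q = 0"
    proof (cases "q = 1")
      case True
      then have "inj_on (\<lambda>k. iter d k p) {..<n}" using q m(3) by simp
      then show thesis
        by (rule smooth_point_exact_period[OF assms p fixed]) (rule that)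
    next
      case False
      then have "q \<ge> 2" using q assms(2) by (cases q) auto
      have "m \<ge> 1" using m(1) by simp
      then show thesis
        by (rule smooth_point_smaller_period[OF assms(1) _ q \<open>q \<ge> 2\<close> p m(2,3)]) (rule that)
    qed
    then show ?thesis by (rule straightening_at_regular_zero)
  qed
  then have "complex_submanifold_dim1 (?S \<inter> UNIV)" unfolding complex_submanifold_dim1_def by simp
  then show ?thesis unfolding smooth_curve_def by blast
qed

end
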